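(* Every separable unital commutative $C^*$-algebra is $RR0$-$AW^*$-projective. In particular, every separable unital commutative $C^*$-algebra is $W^*$-$W^*$-projective.
   Context: A $C^*$-algebra has real rank zero if every self-adjoint element is a norm limit of self-adjoint elements with finite spectrum. A $C^*$-algebra is an $AW^*$-algebra if every set of projections has a least upper bound and every maximal abelian self-adjoint subalgebra is the $C^*$-algebra generated by its projections. A unital $C^*$-algebra $\mathcal{A}$ is $RR0$-$AW^*$-projective if for every unital real rank zero $C^*$-algebra $\mathcal{B}$, every $AW^*$-algebra $\mathcal{M}$, every unital surjective $\ast$-homomorphism $\pi:\mathcal{B}\to\mathcal{M}$ and every unital $\ast$-homomorphism $\phi:\mathcal{A}\to\mathcal{M}$ there is a unital $\ast$-homomorphism $\psi:\mathcal{A}\to\mathcal{B}$ with $\pi\circ\psi=\phi$; $W^*$-$W^*$-projective is defined the same way with $\mathcal{B}$ and $\mathcal{M}$ both ranging over von Neumann algebras. *)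

theory Defs
  imports "HOL-Analysis.Analysis"
begin

class cstar_algebra = banach + real_normed_algebra_1 +
  fixes scaleC :: "complex \<Rightarrow> 'a \<Rightarrow> 'a" (infixr "*\<^sub>C" 75)
    and cstar :: "'a \<Rightarrow> 'a"
  assumes scaleC_add_right: "c *\<^sub>C (x + y) = c *\<^sub>C x + c *\<^sub>C y"
    and scaleC_add_left: "(c + d) *\<^sub>C x = c *\<^sub>C x + d *\<^sub>C x"
    and scaleC_scaleC: "c *\<^sub>C (d *\<^sub>C x) = (c * d) *\<^sub>C x"
    and scaleC_one: "1 *\<^sub>C x = x"
    and scaleR_scaleC: "r *\<^sub>R x = complex_of_real r *\<^sub>C x"
    and norm_scaleC: "norm (c *\<^sub>C x) = cmod c * norm x"
    and mult_scaleC_left: "(c *\<^sub>C x) * y = c *\<^sub>C (x * y)"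
    and mult_scaleC_right: "x * (c *\<^sub>C y) = c *\<^sub>C (x * y)"
    and cstar_add: "cstar (x + y) = cstar x + cstar y"
    and cstar_scaleC: "cstar (c *\<^sub>C x) = cnj c *\<^sub>C cstar x"
    and cstar_mult: "cstar (x * y) = cstar y * cstar x"
    and cstar_cstar: "cstar (cstar x) = x"
    and cstar_identity: "norm (cstar x * x) = (norm x)\<^sup>2"

definition commutative_alg :: "'a::cstar_algebra itself \<Rightarrow> bool" where
  "commutative_alg _ \<longleftrightarrow> (\<forall>x y::'a. x * y = y * x)"

definition separable_alg :: "'a::cstar_algebra itself \<Rightarrow> bool" where
  "separable_alg _ \<longleftrightarrow> (\<exists>D::'a set. countable D \<and> closure D = UNIV)"

definition unital_star_hom :: "('a::cstar_algebra \<Rightarrow> 'b::cstar_algebra) \<Rightarrow> bool" where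
  "unital_star_hom f \<longleftrightarrow>
     (\<forall>x y. f (x + y) = f x + f y) \<and>
     (\<forall>c x. f (c *\<^sub>C x) = c *\<^sub>C f x) \<and>
     (\<forall>x y. f (x * y) = f x * f y) \<and>
     (\<forall>x. f (cstar x) = cstar (f x)) \<and>
     f 1 = 1"

definition invertible_el :: "'a::cstar_algebra \<Rightarrow> bool" where
  "invertible_el x \<longleftrightarrow> (\<exists>y. x * y = 1 \<and> y * x = 1)"

definition spectrum :: "'a::cstar_algebra \<Rightarrow> complex set" where
  "spectrum x = {l. \<not> invertible_el (x - l *\<^sub>C 1)}"

definition self_adjoint :: "'a::cstar_algebra \<Rightarrow> bool" where
  "self_adjoint x \<longleftrightarrow> cstar x = x"

definition real_rank_zero :: "'a::cstar_algebra itself \<Rightarrow> bool" where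
  "real_rank_zero _ \<longleftrightarrow>
     (\<forall>x::'a. self_adjoint x \<longrightarrow>
        x \<in> closure {y. self_adjoint y \<and> finite (spectrum y)})"

definition projection :: "'a::cstar_algebra \<Rightarrow> bool" where
  "projection p \<longleftrightarrow> p * p = p \<and> cstar p = p"

definition proj_le :: "'a::cstar_algebra \<Rightarrow> 'a \<Rightarrow> bool" where
  "proj_le p q \<longleftrightarrow> p * q = p"

definition star_subalgebra :: "'a::cstar_algebra set \<Rightarrow> bool" where
  "star_subalgebra C \<longleftrightarrow> 0 \<in> C \<and>
     (\<forall>x\<in>C. \<forall>y\<in>C. x + y \<in> C \<and> x * y \<in> C) \<and>
     (\<forall>c. \<forall>x\<in>C. c *\<^sub>C x \<in> C) \<and>
     (\<forall>x\<in>C. cstar x \<in> C)"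

definition abelian_set :: "'a::cstar_algebra set \<Rightarrow> bool" where
  "abelian_set C \<longleftrightarrow> (\<forall>x\<in>C. \<forall>y\<in>C. x * y = y * x)"

definition masa :: "'a::cstar_algebra set \<Rightarrow> bool" where
  "masa C \<longleftrightarrow> star_subalgebra C \<and> abelian_set C \<and>
     (\<forall>D. star_subalgebra D \<and> abelian_set D \<and> C \<subseteq> D \<longrightarrow> D = C)"

definition cstar_generated :: "'a::cstar_algebra set \<Rightarrow> 'a set" where
  "cstar_generated S = \<Inter>{D. star_subalgebra D \<and> closed D \<and> S \<subseteq> D}"

definition AW_star_algebra :: "'a::cstar_algebra itself \<Rightarrow> bool" where
  "AW_star_algebra _ \<longleftrightarrow>
     (\<forall>S::'a set. (\<forall>p\<in>S. projection p) \<longrightarrow>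
        (\<exists>u. projection u \<and> (\<forall>p\<in>S. proj_le p u) \<and>
             (\<forall>v. projection v \<and> (\<forall>p\<in>S. proj_le p v) \<longrightarrow> proj_le u v))) \<and>
     (\<forall>C::'a set. masa C \<longrightarrow> C = cstar_generated {p\<in>C. projection p})"

definition bounded_cfunctional :: "('a::cstar_algebra \<Rightarrow> complex) \<Rightarrow> bool" where
  "bounded_cfunctional f \<longleftrightarrow>
     (\<forall>x y. f (x + y) = f x + f y) \<and> (\<forall>c x. f (c *\<^sub>C x) = c * f x) \<and>
     (\<exists>K. \<forall>x. cmod (f x) \<le> K * norm x)"

definition fnorm :: "('a::cstar_algebra \<Rightarrow> complex) \<Rightarrow> real" where
  "fnorm f = Sup ((\<lambda>x. cmod (f x)) ` {x. norm x \<le> 1})"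

text \<open>A C*-algebra is a W*-algebra iff it is (isometrically) the dual of a Banach
  space; equivalently there is a linear subspace S of its bounded dual such that
  the evaluation map a \<mapsto> (f \<mapsto> f a) is an isometric bijection onto S*.\<close>
definition W_star_algebra :: "'a::cstar_algebra itself \<Rightarrow> bool" where
  "W_star_algebra _ \<longleftrightarrow>
     (\<exists>S::('a \<Rightarrow> complex) set.
        (\<forall>f\<in>S. bounded_cfunctional f) \<and> (\<lambda>_. 0) \<in> S \<and>
        (\<forall>f\<in>S. \<forall>g\<in>S. (\<lambda>x. f x + g x) \<in> S) \<and>
        (\<forall>c. \<forall>f\<in>S. (\<lambda>x. c * f x) \<in> S) \<and>
        (\<forall>a::'a. norm a = Sup ((\<lambda>f. cmod (f a)) ` {f\<in>S. fnorm f \<le> 1})) \<and>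
        (\<forall>\<phi>::('a \<Rightarrow> complex) \<Rightarrow> complex.
           (\<forall>f\<in>S. \<forall>g\<in>S. \<phi> (\<lambda>x. f x + g x) = \<phi> f + \<phi> g) \<and>
           (\<forall>c. \<forall>f\<in>S. \<phi> (\<lambda>x. c * f x) = c * \<phi> f) \<and>
           (\<exists>K. \<forall>f\<in>S. cmod (\<phi> f) \<le> K * fnorm f) \<longrightarrow>
           (\<exists>a. \<forall>f\<in>S. \<phi> f = f a)))"

definition RR0_AW_projective :: "'a::cstar_algebra itself \<Rightarrow> 'b::cstar_algebra itself \<Rightarrow> 'm::cstar_algebra itself \<Rightarrow> bool" where
  "RR0_AW_projective _ _ _ \<longleftrightarrow>
     (real_rank_zero TYPE('b) \<and> AW_star_algebra TYPE('m) \<longrightarrow>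
       (\<forall>(\<pi>::'b \<Rightarrow> 'm) (\<phi>::'a \<Rightarrow> 'm).
          unital_star_hom \<pi> \<and> surj \<pi> \<and> unital_star_hom \<phi> \<longrightarrow>
          (\<exists>\<psi>::'a \<Rightarrow> 'b. unital_star_hom \<psi> \<and> \<pi> \<circ> \<psi> = \<phi>)))"

definition W_W_projective :: "'a::cstar_algebra itself \<Rightarrow> 'b::cstar_algebra itself \<Rightarrow> 'm::cstar_algebra itself \<Rightarrow> bool" where
  "W_W_projective _ _ _ \<longleftrightarrow>
     (W_star_algebra TYPE('b) \<and> W_star_algebra TYPE('m) \<longrightarrow>
       (\<forall>(\<pi>::'b \<Rightarrow> 'm) (\<phi>::'a \<Rightarrow> 'm).
          unital_star_hom \<pi> \<and> surj \<pi> \<and> unital_star_hom \<phi> \<longrightarrow>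
          (\<exists>\<psi>::'a \<Rightarrow> 'b. unital_star_hom \<psi> \<and> \<pi> \<circ> \<psi> = \<phi>)))"

end

theory Submission
  imports Defs
begin

text \<open>
  The range of \<open>\<phi>\<close> is separable and lies in a maximal abelian subalgebra of \<open>\<M>\<close>, hence in the closed
  span of a Boolean algebra generated by countably many projections. These are lifted one after the
  other along \<open>\<pi>\<close> to commuting projections. At each stage the atoms of the finite Boolean algebra
  obtained so far are split only if their images split, so \<open>\<pi>\<close> stays isometric on the span of the
  lifts and its inverse on the closure, composed with \<open>\<phi>\<close>, is the required \<open>\<psi>\<close>.
  A projection \<open>p\<close> is lifted, inside the commutant of the projections lifted before, by taking the
  sign of an invertible self-adjoint element; such elements are dense because real rank zero passes to
  corners by Schur complements.

  In a von Neumann algebra, the powers \<open>h\<^sup>n\<close> of \<open>0 \<le> h \<le> 1\<close> converge against the predual to their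
  infimum, which is a projection commuting with everything that commutes with \<open>h\<close>. Taking
  \<open>h = 1 - y\<^sub>+ / K\<close> gives a symmetry \<open>s\<close> with \<open>y s = \<bar>y\<bar>\<close>. Hence \<open>y + \<epsilon> s\<close> is invertible, and
  \<open>\<parallel>y - (K/2) s\<parallel> \<le> K/2\<close> for \<open>\<parallel>y\<parallel> \<le> K\<close>, which exhausts \<open>y\<close> by projections. So von Neumann algebras have
  the two properties that the argument above uses.

  Functional calculus is replaced by the power series of \<open>sqrt (1 - x)\<close>; positivity of a self-adjoint
  \<open>a\<close> is expressed by \<open>\<parallel>t - a\<parallel> \<le> t\<close> for some \<open>t\<close>.
\<close>

section \<open>Square roots and positive elements\<close>

lemma scaleC_zero_right [simp]: "c *\<^sub>C (0::'a::cstar_algebra) = 0"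
  using scaleC_add_right[of c 0 0] by simp

lemma scaleC_zero_left [simp]: "0 *\<^sub>C (x::'a::cstar_algebra) = 0"
  using scaleC_add_left[of 0 0 x] by simp

lemma scaleC_minus_right [simp]: "c *\<^sub>C (- x) = - (c *\<^sub>C (x::'a::cstar_algebra))"
  using scaleC_add_right[of c x "-x"] by (simp add: eq_neg_iff_add_eq_0 add.commute)

lemma scaleC_minus_left [simp]: "(- c) *\<^sub>C (x::'a::cstar_algebra) = - (c *\<^sub>C x)"
  using scaleC_add_left[of c "-c" x] by (simp add: eq_neg_iff_add_eq_0 add.commute)

lemma scaleC_diff_right: "c *\<^sub>C (x - y) = c *\<^sub>C x - c *\<^sub>C (y::'a::cstar_algebra)"
  using scaleC_add_right[of c x "-y"] by simp

lemma i_scaleC_i: "\<i> *\<^sub>C \<i> *\<^sub>C (x::'a::cstar_algebra) = - x"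
  by (simp add: scaleC_scaleC scaleC_one)

lemma scaleC_scaleR_commute: "c *\<^sub>C (r *\<^sub>R (x::'a::cstar_algebra)) = r *\<^sub>R (c *\<^sub>C x)"
  by (simp add: scaleR_scaleC scaleC_scaleC mult.commute)

lemma cstar_zero [simp]: "cstar (0::'a::cstar_algebra) = 0"
  using cstar_add[of 0 "0::'a"] by simp

lemma cstar_minus [simp]: "cstar (- x) = - cstar (x::'a::cstar_algebra)"
  using cstar_add[of x "-x"] by (simp add: eq_neg_iff_add_eq_0 add.commute)

lemma cstar_diff: "cstar (x - y) = cstar x - cstar (y::'a::cstar_algebra)"
  using cstar_add[of x "-y"] by simp

lemma cstar_scaleR [simp]: "cstar (r *\<^sub>R x) = r *\<^sub>R cstar (x::'a::cstar_algebra)"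
  by (simp add: scaleR_scaleC cstar_scaleC)

lemma cstar_one [simp]: "cstar (1::'a::cstar_algebra) = 1"
  using cstar_mult[of "1::'a" "cstar 1"] by (simp add: cstar_cstar)

lemma cstar_sum: "cstar (\<Sum>i\<in>I. f i) = (\<Sum>i\<in>I. cstar (f i::'a::cstar_algebra))"
  by (induction I rule: infinite_finite_induct) (auto simp: cstar_add)

lemma cstar_power: "cstar (x ^ n) = cstar (x::'a::cstar_algebra) ^ n"
  by (induction n) (auto simp: cstar_mult power_commutes)

lemma norm_cstar [simp]: "norm (cstar x) = norm (x::'a::cstar_algebra)"
proof -
  have *: "norm y \<le> norm (cstar y)" for y :: 'a
  proof (cases "y = 0")
    case False
    have "norm y * norm y \<le> norm (cstar y) * norm y"
      using cstar_identity[of y] norm_mult_ineq[of "cstar y" y] by (simp add: power2_eq_square)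
    with False show ?thesis by simp
  qed simp
  show ?thesis using *[of x] *[of "cstar x"] by (simp add: cstar_cstar)
qed

lemma bounded_linear_cstar: "bounded_linear (cstar :: 'a::cstar_algebra \<Rightarrow> 'a)"
  by (rule bounded_linear_intro[where K = 1]) (auto simp: cstar_add)

lemma bounded_linear_scaleC: "bounded_linear (\<lambda>x::'a::cstar_algebra. c *\<^sub>C x)"
  by (rule bounded_linear_intro[where K = "cmod c"])
    (auto simp: scaleC_add_right scaleC_scaleR_commute norm_scaleC)

named_theorems sa_intros

lemma self_adjointD: "self_adjoint x \<Longrightarrow> cstar x = x"
  by (simp add: self_adjoint_def)

lemma sa_0 [sa_intros, simp]: "self_adjoint (0::'a::cstar_algebra)"
  and sa_1 [sa_intros, simp]: "self_adjoint (1::'a::cstar_algebra)"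
  by (auto simp: self_adjoint_def)

lemma sa_add [sa_intros]: "self_adjoint x \<Longrightarrow> self_adjoint y \<Longrightarrow> self_adjoint (x + y)"
  and sa_diff [sa_intros]: "self_adjoint x \<Longrightarrow> self_adjoint y \<Longrightarrow> self_adjoint (x - y)"
  and sa_minus [sa_intros]: "self_adjoint x \<Longrightarrow> self_adjoint (- x)"
  and sa_scaleR [sa_intros]: "self_adjoint x \<Longrightarrow> self_adjoint (r *\<^sub>R x)"
  and sa_square [sa_intros]: "self_adjoint x \<Longrightarrow> self_adjoint (x * x)"
  and sa_power [sa_intros]: "self_adjoint x \<Longrightarrow> self_adjoint (x ^ n)"
  and sa_sandwich: "self_adjoint x \<Longrightarrow> self_adjoint (cstar z * x * z)"
  and sa_mult: "self_adjoint x \<Longrightarrow> self_adjoint y \<Longrightarrow> x * y = y * x \<Longrightarrow> self_adjoint (x * y)"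
  for x y z :: "'a::cstar_algebra"
  by (auto simp: self_adjoint_def cstar_add cstar_diff cstar_mult cstar_power cstar_cstar mult.assoc)

lemma sa_sum [sa_intros]:
  "(\<And>i. i \<in> I \<Longrightarrow> self_adjoint (f i)) \<Longrightarrow> self_adjoint (\<Sum>i\<in>I. f i :: 'a::cstar_algebra)"
  by (simp add: self_adjoint_def cstar_sum)

lemma norm_sa_square: "self_adjoint x \<Longrightarrow> norm (x * x) = (norm (x::'a::cstar_algebra))\<^sup>2"
  using cstar_identity[of x] by (simp add: self_adjoint_def)

definition re_part :: "'a::cstar_algebra \<Rightarrow> 'a" where
  "re_part x = (1/2) *\<^sub>R (x + cstar x)"

definition im_part :: "'a::cstar_algebra \<Rightarrow> 'a" where
  "im_part x = (1/2) *\<^sub>R (\<i> *\<^sub>C (cstar x - x))"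

lemma sa_re_part [sa_intros]: "self_adjoint (re_part x)"
  and sa_im_part [sa_intros]: "self_adjoint (im_part x)"
  by (simp_all add: self_adjoint_def re_part_def im_part_def cstar_add cstar_diff cstar_scaleC
      cstar_cstar scaleC_diff_right add.commute)

lemma re_im_part: "re_part x + \<i> *\<^sub>C im_part x = x"
proof -
  have "\<i> *\<^sub>C im_part x = (1/2) *\<^sub>R (x - cstar x)"
    by (simp add: im_part_def scaleC_scaleR_commute i_scaleC_i scaleC_diff_right)
  then have "re_part x + \<i> *\<^sub>C im_part x = (1/2) *\<^sub>R x + (1/2) *\<^sub>R x"
    by (simp add: re_part_def scaleR_add_right scaleR_diff_right)
  then show ?thesis by (simp flip: scaleR_add_left)
qed

lemma norm_re_part: "norm (re_part x) \<le> norm x"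
  using norm_triangle_ineq[of x "cstar x"] by (simp add: re_part_def)

lemma norm_im_part: "norm (im_part x) \<le> norm x"
  using norm_triangle_ineq4[of "cstar x" x] by (simp add: im_part_def norm_scaleC)

text \<open>The element \<open>a + \<i> b\<close> is \<open>K\<close> times a unitary.\<close>
lemma norm_le_of_sum_squares:
  fixes a b :: "'a::cstar_algebra"
  assumes "self_adjoint a" "self_adjoint b" "a * b = b * a"
    and sq: "a * a + b * b = (K\<^sup>2) *\<^sub>R 1" and "K \<ge> 0"
  shows "norm a \<le> K"
proof -
  define u where "u = a + \<i> *\<^sub>C b"
  have cu: "cstar u = a - \<i> *\<^sub>C b"
    using assms by (simp add: u_def cstar_add cstar_scaleC self_adjoint_def)
  have "cstar u * u = a * a + b * b"
    unfolding cu unfolding u_def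
    by (simp add: algebra_simps mult_scaleC_left mult_scaleC_right scaleC_diff_right i_scaleC_i \<open>a * b = b * a\<close>)
  then have "(norm u)\<^sup>2 = K\<^sup>2"
    using cstar_identity[of u] sq by simp
  then have u: "norm u = K"
    using \<open>K \<ge> 0\<close> by (simp add: power2_eq_iff_nonneg)
  have "re_part u = (1/2) *\<^sub>R (a + a)"
    unfolding re_part_def cu by (simp add: u_def)
  then have "re_part u = a" by (simp flip: scaleR_2)
  with norm_re_part[of u] u show ?thesis by simp
qed

section \<open>The Taylor coefficients of sqrt (1 - x) at 0 and their absolute summability\<close>

definition sqrt_coeff :: "nat \<Rightarrow> real" where
  "sqrt_coeff n = (-1) ^ n * ((1/2) gchoose n)"

lemma sqrt_coeff_0 [simp]: "sqrt_coeff 0 = 1"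
  by (simp add: sqrt_coeff_def)

text \<open>After absorbing the sign, a coefficient is a product of factors
  \<open>real i - c\<close> over a factorial. For \<open>c = 1/2\<close> only the factor at 0 is
  negative, for \<open>c = -1/2\<close> none is.\<close>

lemma sqrt_coeff_Suc_nonpos: "sqrt_coeff (Suc n) \<le> 0"
  and minus_half_gchoose: "(-1) ^ n * ((-1/2::real) gchoose n) \<ge> 0"
proof -
  have *: "(-1) ^ n * (\<Prod>i<n. c - real i) = (\<Prod>i<n. real i - c)" for c n
    by (induction n) (auto simp: algebra_simps)
  have "(-1) ^ n * ((-1/2::real) gchoose n) = (\<Prod>i<n. real i + 1/2) / fact n"
    using *[of n "-1/2"] by (simp add: gbinomial_prod_rev atLeast0LessThan)
  also have "\<dots> \<ge> 0" by (intro divide_nonneg_pos prod_nonneg) auto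
  finally show "(-1) ^ n * ((-1/2::real) gchoose n) \<ge> 0" .
  have "sqrt_coeff (Suc n) = (\<Prod>i<Suc n. real i - 1/2) / fact (Suc n)"
    using *[of "Suc n" "1/2"] by (simp add: sqrt_coeff_def gbinomial_prod_rev atLeast0LessThan)
  also have "(\<Prod>i<Suc n. real i - 1/2) = (-1/2) * (\<Prod>i<n. real (Suc i) - 1/2)"
    by (subst prod.lessThan_Suc_shift) simp
  finally have "sqrt_coeff (Suc n) = (-1/2) * (\<Prod>i<n. real (Suc i) - 1/2) / fact (Suc n)" .
  moreover have "(-1/2) * (\<Prod>i<n. real (Suc i) - 1/2) \<le> 0"
    by (intro mult_nonpos_nonneg prod_nonneg) auto
  ultimately show "sqrt_coeff (Suc n) \<le> 0"
    by (simp only: divide_nonpos_pos fact_gt_zero)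
qed

text \<open>Multiplying the series of (1 - x)^(1/2) by that of 1/(1 - x) gives (1 - x)^(-1/2), so
  the partial sums of \<open>sqrt_coeff\<close> are the coefficients of the latter and hence
  nonnegative; all terms after the initial 1 are nonpositive.\<close>

lemma sum_abs_sqrt_coeff: "(\<Sum>k<n. \<bar>sqrt_coeff (Suc k)\<bar>) \<le> 1"
proof -
  have "(\<Sum>k<n. \<bar>sqrt_coeff (Suc k)\<bar>) = - (\<Sum>k<n. sqrt_coeff (Suc k))"
    using sqrt_coeff_Suc_nonpos by (simp add: abs_of_nonpos flip: sum_negf)
  also have "\<dots> = 1 - (\<Sum>k\<le>n. sqrt_coeff k)"
    by (simp add: sum.atMost_shift)
  also have "(\<Sum>k\<le>n. sqrt_coeff k) = (-1) ^ n * ((-1/2) gchoose n)"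
    using gbinomial_sum_lower_neg[of "1/2::real" n] by (simp add: sqrt_coeff_def mult.commute)
  finally show ?thesis using minus_half_gchoose[of n] by linarith
qed

lemma summable_abs_sqrt_coeff: "summable (\<lambda>n. \<bar>sqrt_coeff n\<bar>)"
  and suminf_abs_sqrt_coeff: "(\<Sum>n. \<bar>sqrt_coeff (Suc n)\<bar>) \<le> 1"
proof -
  have "summable (\<lambda>n. \<bar>sqrt_coeff (Suc n)\<bar>)"
    by (rule summableI_nonneg_bounded[where x = 1]) (use sum_abs_sqrt_coeff in auto)
  then show "summable (\<lambda>n. \<bar>sqrt_coeff n\<bar>)" "(\<Sum>n. \<bar>sqrt_coeff (Suc n)\<bar>) \<le> 1"
    using sum_abs_sqrt_coeff summable_Suc_iff[of "\<lambda>n. \<bar>sqrt_coeff n\<bar>"]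
    by (auto intro: suminf_le_const)
qed

text \<open>Vandermonde's identity for 1/2 + 1/2 = 1: the square of the series is the polynomial 1 -
  x.\<close>

lemma sqrt_coeff_convolution:
  "(\<Sum>i\<le>n. sqrt_coeff i * sqrt_coeff (n - i)) = (if n = 0 then 1 else if n = 1 then -1 else 0)"
proof -
  have "(\<Sum>i\<le>n. sqrt_coeff i * sqrt_coeff (n - i))
      = (-1) ^ n * (\<Sum>i\<le>n. ((1/2::real) gchoose i) * ((1/2) gchoose (n - i)))"
    unfolding sqrt_coeff_def sum_distrib_left
    by (rule sum.cong[OF refl]) (simp flip: power_add)
  also have "(\<Sum>i\<le>n. ((1/2::real) gchoose i) * ((1/2) gchoose (n - i))) = 1 gchoose n"
    using gbinomial_Vandermonde[of "1/2::real" "1/2" n] by (simp add: atLeast0AtMost)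
  also have "(1::real) gchoose n = of_nat (1 choose n)"
    using binomial_gbinomial[of 1 n, where ?'a = real] by simp
  also have "(-1) ^ n * real (1 choose n) = (if n = 0 then 1 else if n = 1 then -1 else 0)"
    by (cases n) (auto simp: binomial_eq_0)
  finally show ?thesis .
qed

text \<open>The series is evaluated at \<open>x\<close>. Absolute summability of the coefficients
  covers the boundary case \<open>norm x = 1\<close>, on which \<open>positive_sqrt\<close> relies;
  the bound on \<open>1 - b\<close> will make \<open>b\<close> positive.\<close>

lemma sqrt_one_minus:
  fixes x :: "'a::cstar_algebra"
  assumes x: "norm x \<le> 1"
  obtains b where "b * b = 1 - x" "self_adjoint x \<Longrightarrow> self_adjoint b"
    "\<And>z. z * x = x * z \<Longrightarrow> z * b = b * z" "norm (1 - b) \<le> 1"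
proof -
  define f where "f n = sqrt_coeff n *\<^sub>R x ^ n" for n
  have xn: "norm (x ^ n) \<le> 1" for n
    using norm_power_ineq[of x n] power_le_one[OF norm_ge_zero x, of n] by linarith
  have fb: "norm (f n) \<le> \<bar>sqrt_coeff n\<bar>" for n
    using mult_left_mono[OF xn, of "\<bar>sqrt_coeff n\<bar>" n] by (simp add: f_def)
  have sn: "summable (\<lambda>n. norm (f n))"
    by (rule summable_comparison_test'[OF summable_abs_sqrt_coeff]) (use fb in auto)
  then have sf: "summable f" by (rule summable_norm_cancel)
  define b where "b = suminf f"
  have sb: "f sums b" unfolding b_def using sf by (rule summable_sums)
  have "(\<lambda>n. \<Sum>i\<le>n. f i * f (n - i)) sums (b * b)"
    unfolding b_def by (rule Cauchy_product_sums[OF sn sn])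
  moreover have "(\<Sum>i\<le>n. f i * f (n - i)) = (if n \<in> {0,1} then (if n = 0 then 1 else - x) else 0)" for n
  proof -
    have "(\<Sum>i\<le>n. f i * f (n - i)) = (\<Sum>i\<le>n. sqrt_coeff i * sqrt_coeff (n - i)) *\<^sub>R x ^ n"
      unfolding scaleR_sum_left by (rule sum.cong[OF refl]) (simp add: f_def flip: power_add)
    then show ?thesis by (simp add: sqrt_coeff_convolution)
  qed
  moreover have "(\<lambda>n. if n \<in> {0,1::nat} then (if n = 0 then 1 else - x) else 0) sums
      (\<Sum>n\<in>{0,1::nat}. if n = 0 then 1 else - x)"
    by (rule sums_If_finite_set) simp
  ultimately have bb: "b * b = 1 - x"
    using sums_unique2 by fastforce
  have sa: "self_adjoint b" if "self_adjoint x"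
  proof -
    have "(\<lambda>n. cstar (f n)) sums cstar b"
      using bounded_linear.sums[OF bounded_linear_cstar sb] .
    moreover have "cstar (f n) = f n" for n
      using that by (simp add: f_def cstar_power self_adjoint_def)
    ultimately show ?thesis
      using sb sums_unique2 by (fastforce simp: self_adjoint_def)
  qed
  have comm: "z * b = b * z" if "z * x = x * z" for z
  proof -
    have "z * x ^ n = x ^ n * z" for n
      using that by (metis power_commuting_commutes)
    then have "z * f n = f n * z" for n
      by (simp add: f_def)
    moreover have "(\<lambda>n. z * f n) sums (z * b)" "(\<lambda>n. f n * z) sums (b * z)"
      using sb by (auto intro: sums_mult sums_mult2)
    ultimately show ?thesis by (simp add: sums_unique2)
  qed
  have "(\<lambda>n. f (Suc n)) sums (b - 1)"
    using sb sums_Suc_iff[of f "b - 1"] by (simp add: f_def)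
  then have eq: "b - 1 = (\<Sum>n. f (Suc n))" by (simp add: sums_unique)
  have s1: "summable (\<lambda>n. \<bar>sqrt_coeff (Suc n)\<bar>)"
    using summable_Suc_iff[of "\<lambda>n. \<bar>sqrt_coeff n\<bar>"] summable_abs_sqrt_coeff by simp
  have "norm (b - 1) \<le> (\<Sum>n. \<bar>sqrt_coeff (Suc n)\<bar>)"
    unfolding eq by (rule norm_suminf_le) (use fb s1 in auto)
  then have "norm (1 - b) \<le> 1"
    using suminf_abs_sqrt_coeff by (simp add: norm_minus_commute)
  with bb sa comm show thesis by (rule that)
qed

section \<open>The cone of positive elements and square roots in it\<close>

definition positive_el :: "'a::cstar_algebra \<Rightarrow> bool" where
  "positive_el a \<longleftrightarrow> self_adjoint a \<and> (\<exists>t. norm (t *\<^sub>R 1 - a) \<le> t)"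

lemma positive_el_sa: "positive_el a \<Longrightarrow> self_adjoint a"
  by (simp add: positive_el_def)

lemma positive_elI: "self_adjoint a \<Longrightarrow> norm (t *\<^sub>R 1 - a) \<le> t \<Longrightarrow> positive_el a"
  by (auto simp: positive_el_def)

lemma positive_add:
  assumes "positive_el a" "positive_el (b::'a::cstar_algebra)"
  shows "positive_el (a + b)"
proof -
  obtain s t where *: "norm (s *\<^sub>R 1 - a) \<le> s" "norm (t *\<^sub>R 1 - b) \<le> t"
    using assms by (auto simp: positive_el_def)
  have "(s + t) *\<^sub>R 1 - (a + b) = (s *\<^sub>R 1 - a) + (t *\<^sub>R 1 - b)"
    by (simp add: algebra_simps)
  then have "norm ((s + t) *\<^sub>R 1 - (a + b)) \<le> s + t"
    using * norm_triangle_ineq[of "s *\<^sub>R 1 - a" "t *\<^sub>R 1 - b"] by (simp only:)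
  then show ?thesis
    by (rule positive_elI[rotated]) (intro sa_add positive_el_sa assms)
qed

lemma positive_scaleR:
  assumes "positive_el (a::'a::cstar_algebra)" "r \<ge> 0"
  shows "positive_el (r *\<^sub>R a)"
proof -
  obtain t where "norm (t *\<^sub>R 1 - a) \<le> t" using assms by (auto simp: positive_el_def)
  then have "r * norm (t *\<^sub>R 1 - a) \<le> r * t" using assms by (simp add: mult_left_mono)
  moreover have "(r * t) *\<^sub>R 1 - r *\<^sub>R a = r *\<^sub>R (t *\<^sub>R 1 - a)"
    by (simp add: algebra_simps)
  ultimately show ?thesis
    using assms by (intro positive_elI[where t = "r * t"]) (auto intro: sa_scaleR positive_el_sa)
qed

lemma positive_bound:
  assumes "self_adjoint (a::'a::cstar_algebra)" "norm a \<le> K"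
  shows "positive_el (K *\<^sub>R 1 - a)" "positive_el (K *\<^sub>R 1 + a)"
  using assms by (auto intro!: positive_elI[where t = K] sa_intros)

lemma positive_of_real: "r \<ge> 0 \<Longrightarrow> positive_el (r *\<^sub>R (1::'a::cstar_algebra))"
  by (auto intro!: positive_elI[where t = r] sa_intros)

lemma positive_0 [simp]: "positive_el (0::'a::cstar_algebra)"
  and positive_1 [simp]: "positive_el (1::'a::cstar_algebra)"
  using positive_of_real[of 0] positive_of_real[of 1] by auto

lemma positive_sum:
  "(\<And>i. i \<in> I \<Longrightarrow> positive_el (f i)) \<Longrightarrow> positive_el (\<Sum>i\<in>I. f i :: 'a::cstar_algebra)"
  by (induction I rule: infinite_finite_induct) (auto intro: positive_add)

text \<open>After scaling to \<open>norm y \<le> 1\<close>, a root \<open>b\<close> of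
  \<open>1 - y * y\<close> satisfies \<open>b * b + y * y = 1\<close>, hence has norm at most 1, and
  \<open>norm (1 - y * y) = norm (b * b) \<le> 1\<close> is the positivity of
  \<open>y * y\<close>.\<close>

lemma positive_square:
  assumes x: "self_adjoint (x::'a::cstar_algebra)"
  shows "positive_el (x * x)"
proof -
  define k where "k = norm x + 1"
  define y where "y = (1 / k) *\<^sub>R x"
  have k: "k > 0" by (simp add: k_def add_nonneg_pos)
  have xy: "x * x = k\<^sup>2 *\<^sub>R (y * y)" and y: "self_adjoint y"
    using k x by (auto simp: y_def power2_eq_square intro: sa_scaleR)
  have "norm y \<le> 1" using k by (simp add: y_def k_def field_simps)
  then have yy: "norm (y * y) \<le> 1"
    using y by (simp add: norm_sa_square power_le_one)
  obtain b where b: "b * b = 1 - y * y" "self_adjoint b" "y * b = b * y"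
    using sqrt_one_minus[OF yy] y by (metis mult.assoc sa_square)
  have "norm b \<le> 1"
    by (rule norm_le_of_sum_squares[of _ y]) (use b y in auto)
  then have "norm (b * b) \<le> 1"
    using b(2) by (simp add: norm_sa_square power_le_one)
  then have "positive_el (y * y)"
    using y b(1) by (intro positive_elI[where t = 1] sa_square) auto
  then show ?thesis unfolding xy by (rule positive_scaleR) simp
qed

text \<open>With \<open>x = 1 - (1/t) *\<^sub>R a\<close>, of norm at most 1, \<open>a\<close> is
  \<open>t\<close> times \<open>1 - x\<close>; the root of \<open>1 - x\<close> lies within distance
  1 of 1 and so is itself positive.\<close>

lemma positive_sqrt:
  fixes a :: "'a::cstar_algebra"
  assumes "positive_el a"
  obtains b where "positive_el b" "b * b = a" "\<And>z. z * a = a * z \<Longrightarrow> z * b = b * z"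
proof -
  obtain t where t: "norm (t *\<^sub>R 1 - a) \<le> t" and sa: "self_adjoint a"
    using assms by (auto simp: positive_el_def)
  have "t \<ge> 0" using t norm_ge_zero order_trans by blast
  show thesis
  proof (cases "t = 0")
    case True
    then show ?thesis using t by (intro that[of 0]) auto
  next
    case False
    with \<open>t \<ge> 0\<close> have tp: "t > 0" by simp
    define x where "x = 1 - (1/t) *\<^sub>R a"
    have "x = (1/t) *\<^sub>R (t *\<^sub>R 1 - a)" using tp by (simp add: x_def algebra_simps)
    then have "norm x = norm (t *\<^sub>R 1 - a) / t" using tp by simp
    then have "norm x \<le> 1" using t tp by simp
    then obtain b where b: "b * b = 1 - x" "self_adjoint x \<Longrightarrow> self_adjoint b"
      "\<And>z. z * x = x * z \<Longrightarrow> z * b = b * z" "norm (1 - b) \<le> 1"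
      using sqrt_one_minus by blast
    have "self_adjoint x" unfolding x_def by (intro sa_intros sa)
    then have "positive_el b" using b(2,4) by (intro positive_elI[where t = 1]) simp_all
    then have "positive_el (sqrt t *\<^sub>R b)" using tp by (intro positive_scaleR) auto
    moreover have "(sqrt t *\<^sub>R b) * (sqrt t *\<^sub>R b) = t *\<^sub>R (b * b)" using tp by simp
    then have "(sqrt t *\<^sub>R b) * (sqrt t *\<^sub>R b) = a"
      unfolding b(1) using tp by (simp add: x_def)
    moreover have "z * (sqrt t *\<^sub>R b) = (sqrt t *\<^sub>R b) * z" if "z * a = a * z" for z
      using b(3)[of z] that by (simp add: x_def left_diff_distrib right_diff_distrib)
    ultimately show ?thesis by (rule that)
  qed
qed

text \<open>Commuting positive elements have commuting positive roots \<open>c\<close> and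
  \<open>d\<close>, and \<open>a * b\<close> is the square of the self-adjoint
  \<open>c * d\<close>.\<close>

lemma positive_mult:
  assumes "positive_el a" "positive_el b" and ab: "a * b = b * (a::'a::cstar_algebra)"
  shows "positive_el (a * b)"
proof -
  obtain c where c: "positive_el c" "c * c = a" "b * c = c * b"
    using positive_sqrt[OF assms(1)] ab by metis
  obtain d where d: "positive_el d" "d * d = b" "c * d = d * c"
    using positive_sqrt[OF assms(2)] c by metis
  have "a * b = (c * d) * (c * d)"
    using c(2) d(2,3) by (metis mult.assoc)
  moreover have "self_adjoint (c * d)" using c d by (intro sa_mult positive_el_sa)
  ultimately show ?thesis using positive_square by simp
qed

text \<open>Converse of \<open>positive_bound\<close>. The product of K - a and K + a is positive,
  and a root \<open>b\<close> of it satisfies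
  \<open>a * a + b * b = K\<^sup>2 *\<^sub>R 1\<close>.\<close>

lemma norm_le_iff_positive:
  assumes a: "self_adjoint (a::'a::cstar_algebra)"
    and p: "positive_el (K *\<^sub>R 1 - a)" "positive_el (K *\<^sub>R 1 + a)" and K: "K \<ge> 0"
  shows "norm a \<le> K"
proof -
  have "positive_el ((K *\<^sub>R 1 - a) * (K *\<^sub>R 1 + a))"
    by (rule positive_mult[OF p]) (simp add: algebra_simps)
  moreover have eq: "(K *\<^sub>R 1 - a) * (K *\<^sub>R 1 + a) = K\<^sup>2 *\<^sub>R 1 - a * a"
    by (simp add: algebra_simps power2_eq_square)
  ultimately have "positive_el (K\<^sup>2 *\<^sub>R 1 - a * a)" by simp
  then obtain b where b: "positive_el b" "b * b = K\<^sup>2 *\<^sub>R 1 - a * a"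
    "\<And>z. z * (K\<^sup>2 *\<^sub>R 1 - a * a) = (K\<^sup>2 *\<^sub>R 1 - a * a) * z \<Longrightarrow> z * b = b * z"
    using positive_sqrt by blast
  have "a * b = b * a"
    by (rule b(3)) (simp add: algebra_simps)
  then show ?thesis
    by (rule norm_le_of_sum_squares[OF a positive_el_sa[OF b(1)] _ _ K]) (simp add: b)
qed

lemma positive_antisym:
  assumes a: "positive_el a" and ma: "positive_el (- a)"
  shows "a = (0::'a::cstar_algebra)"
  using norm_le_iff_positive[of a 0] assms positive_el_sa by auto

lemma positive_le_antisym:
  "positive_el (a - b) \<Longrightarrow> positive_el (b - a) \<Longrightarrow> a = (b::'a::cstar_algebra)"
  using positive_antisym[of "a - b"] by simp

text \<open>The witness in \<open>positive_el\<close> can be any bound for the norm; order relations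
  thus become norm inequalities with a prescribed \<open>t\<close>, which survive limits.\<close>

lemma positive_norm:
  assumes "positive_el (a::'a::cstar_algebra)" "norm a \<le> t"
  shows "norm (t *\<^sub>R 1 - a) \<le> t"
proof (rule norm_le_iff_positive)
  have sa: "self_adjoint a" using assms positive_el_sa by blast
  then show "self_adjoint (t *\<^sub>R 1 - a)" by (intro sa_intros)
  show "positive_el (t *\<^sub>R 1 - (t *\<^sub>R 1 - a))" using assms by simp
  show t: "t \<ge> 0" using assms norm_ge_zero order_trans by blast
  show "positive_el (t *\<^sub>R 1 + (t *\<^sub>R 1 - a))"
    by (intro positive_add positive_bound positive_of_real sa assms t)
qed

text \<open>For \<open>e \<le> 1\<close> all the elements a + e share the witness
  \<open>norm a + 1\<close>; letting \<open>e\<close> tend to 0 gives this witness for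
  \<open>a\<close>.\<close>

lemma positive_archimedean:
  assumes p: "\<And>e. e > 0 \<Longrightarrow> positive_el (a + e *\<^sub>R 1)"
  shows "positive_el (a::'a::cstar_algebra)"
proof (rule positive_elI)
  show "self_adjoint a"
    using sa_diff[OF positive_el_sa[OF p[of 1]] sa_1] by simp
  show "norm ((norm a + 1) *\<^sub>R 1 - a) \<le> norm a + 1"
  proof (rule field_le_epsilon)
    fix e :: real assume "e > 0"
    define d where "d = min e 1"
    have d: "d > 0" "d \<le> 1" "d \<le> e" using \<open>e > 0\<close> by (auto simp: d_def)
    have "norm (a + d *\<^sub>R 1) \<le> norm a + 1"
      using norm_triangle_ineq[of a "d *\<^sub>R 1"] d by simp
    then have "norm ((norm a + 1) *\<^sub>R 1 - (a + d *\<^sub>R 1)) \<le> norm a + 1"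
      by (intro positive_norm p d)
    then show "norm ((norm a + 1) *\<^sub>R 1 - a) \<le> norm a + 1 + e"
      using norm_triangle_ineq[of "(norm a + 1) *\<^sub>R 1 - (a + d *\<^sub>R 1)" "d *\<^sub>R 1"] d
      by (simp add: algebra_simps)
  qed
qed

text \<open>Neumann series for \<open>x = 1 - (1/t) *\<^sub>R z\<close>, whose norm is below
  1.\<close>

lemma invertible_near_scalar:
  assumes "norm (t *\<^sub>R 1 - z) < t"
  shows "invertible_el (z::'a::cstar_algebra)"
proof -
  have t: "t > 0" using assms norm_ge_zero le_less_trans by blast
  define x where "x = 1 - (1/t) *\<^sub>R z"
  have "x = (1/t) *\<^sub>R (t *\<^sub>R 1 - z)" using t by (simp add: x_def algebra_simps)
  then have "norm x = norm (t *\<^sub>R 1 - z) / t" using t by simp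
  then have x: "norm x < 1" using assms t by simp
  have "summable (\<lambda>n. norm (x ^ n))"
    by (rule summable_comparison_test'[OF summable_geometric[of "norm x"]])
      (use x norm_power_ineq in auto)
  then have s: "summable (\<lambda>n. x ^ n)" by (rule summable_norm_cancel)
  define y where "y = (\<Sum>n. x ^ n)"
  have y: "(\<lambda>n. x ^ n) sums y" unfolding y_def using s by (rule summable_sums)
  then have "(\<lambda>n. x ^ Suc n) sums (y - 1)" by (subst sums_Suc_iff) simp
  moreover have "(\<lambda>n. x ^ Suc n) sums (x * y)" "(\<lambda>n. x ^ Suc n) sums (y * x)"
    using sums_mult[OF y, of x] sums_mult2[OF y, of x] by (simp_all add: power_commutes)
  ultimately have "x * y = y - 1" "y * x = y - 1" using sums_unique2 by blast+
  then have "(1 - x) * y = 1" "y * (1 - x) = 1" by (simp_all add: left_diff_distrib right_diff_distrib)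
  moreover have "z = t *\<^sub>R (1 - x)" using t by (simp add: x_def)
  ultimately have "z * ((1/t) *\<^sub>R y) = 1" "((1/t) *\<^sub>R y) * z = 1"
    using t by simp_all
  then show ?thesis unfolding invertible_el_def by blast
qed

lemma invertible_positive_plus:
  assumes "positive_el (a::'a::cstar_algebra)" "norm e < d"
  shows "invertible_el (a + d *\<^sub>R 1 + e)"
proof -
  obtain t where t: "norm (t *\<^sub>R 1 - a) \<le> t" using assms by (auto simp: positive_el_def)
  have "(t + d) *\<^sub>R 1 - (a + d *\<^sub>R 1 + e) = (t *\<^sub>R 1 - a) - e" by (simp add: algebra_simps)
  then have "norm ((t + d) *\<^sub>R 1 - (a + d *\<^sub>R 1 + e)) < t + d"
    using norm_triangle_ineq4[of "t *\<^sub>R 1 - a" e] t assms by (simp only:)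
  then show ?thesis by (rule invertible_near_scalar)
qed

section \<open>Inverses, uniqueness of positive roots and absolute values\<close>

lemma inverse_commute:
  fixes x y z :: "'a::monoid_mult"
  assumes "x * y = 1" "y * x = 1" "z * x = x * z"
  shows "z * y = y * z"
  using assms by (metis mult.assoc mult_1_left mult_1_right)

lemma sa_inverse:
  fixes x y :: "'a::cstar_algebra"
  assumes "x * y = 1" "y * x = 1" "self_adjoint x"
  shows "self_adjoint y"
proof -
  have "cstar y * x = 1" using arg_cong[OF assms(1), of cstar] assms(3)
    by (simp add: cstar_mult self_adjoint_def)
  then show ?thesis using assms unfolding self_adjoint_def
    by (metis mult.assoc mult_1_left mult_1_right)
qed

text \<open>\<open>b\<close> is the product of \<open>a\<close> and the square \<open>b * b\<close>,
  which commute.\<close>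

lemma positive_inverse:
  fixes a b :: "'a::cstar_algebra"
  assumes "positive_el a" "a * b = 1" "b * a = 1"
  shows "positive_el b"
proof -
  have "self_adjoint b" using assms by (blast intro: sa_inverse positive_el_sa)
  moreover have "a * (b * b) = b" using assms(2) by (simp flip: mult.assoc)
  moreover have "(b * b) * a = b" using assms(3) by (simp add: mult.assoc)
  ultimately show ?thesis
    using positive_mult[OF assms(1) positive_square[of b]] by simp
qed

text \<open>For commuting \<open>b \<plusminus> y\<close> with positive product and positive invertible sum, each factor is
  positive; adding \<open>e > 0\<close> to \<open>b\<close> makes the sum invertible.\<close>
lemma positive_diff_of_square:
  fixes b y :: "'a::cstar_algebra"
  assumes y: "self_adjoint y" and b: "positive_el b" and yb: "y * b = b * y"
    and sq: "positive_el (b * b - y * y)"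
  shows "positive_el (b - y)"
proof (rule positive_archimedean)
  fix e :: real assume e: "e > 0"
  define c where "c = b + e *\<^sub>R 1"
  have c: "positive_el c" unfolding c_def by (intro positive_add b positive_of_real) (use e in simp)
  have yc: "y * c = c * y" by (simp add: c_def algebra_simps yb)
  have "invertible_el (b + e *\<^sub>R 1 + 0)" by (rule invertible_positive_plus[OF b]) (use e in simp)
  then obtain d where d: "c * d = 1" "d * c = 1" by (auto simp: invertible_el_def c_def)
  have yd: "y * d = d * y" using inverse_commute[OF d yc] .
  have cc: "c * c - y * y = (b * b - y * y) + ((2 * e) *\<^sub>R b + (e * e) *\<^sub>R 1)"
    by (simp add: c_def algebra_simps flip: scaleR_2)
  \<comment> \<open>This sum of two positive elements equals 2 c (c - y); multiplying by the inverse
    of \<open>c\<close>, which is positive and commutes with it, leaves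
    \<open>c - y\<close>.\<close>
  have "positive_el ((c - y) * (c - y) + (c * c - y * y))"
    unfolding cc using e y c
    by (intro positive_add sq positive_scaleR b positive_of_real positive_square sa_intros)
      (auto intro: positive_el_sa)
  moreover have eq: "(c - y) * (c - y) + (c * c - y * y) = 2 *\<^sub>R (c * (c - y))"
    by (simp add: algebra_simps yc scaleR_2)
  ultimately have "positive_el (2 *\<^sub>R (c * (c - y)))" by simp
  from positive_scaleR[OF this, of "1/2"] have p: "positive_el (c * (c - y))" by simp
  have "d * (c * (c - y)) = c - y" using d by (metis mult.assoc mult_1_left)
  moreover have "(c * (c - y)) * d = c - y"
    using d yd yc by (simp add: algebra_simps) (metis d(1) mult.assoc mult.right_neutral)
  ultimately have "positive_el (c - y)"
    using positive_mult[OF positive_inverse[OF c d] p] by simp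
  then show "positive_el (b - y + e *\<^sub>R 1)" by (simp add: c_def algebra_simps)
qed

text \<open>The root \<open>w\<close> from \<open>positive_sqrt\<close> commutes with everything
  that commutes with \<open>b * b\<close>, in particular with any positive root \<open>d\<close>.
  The squares being equal, \<open>positive_diff_of_square\<close> gives both
  \<open>d \<le> w\<close> and \<open>w \<le> d\<close>.\<close>

lemma positive_sqrt_unique:
  fixes b c :: "'a::cstar_algebra"
  assumes b: "positive_el b" and c: "positive_el c" and eq: "b * b = c * c"
  shows "b = c"
proof -
  have "positive_el (b * b)" using positive_square positive_el_sa b by blast
  then obtain w where w: "positive_el w" "w * w = b * b" "\<And>z. z * (b * b) = (b * b) * z \<Longrightarrow> z * w = w * z"
    using positive_sqrt by blast
  have *: "d = w" if d: "positive_el d" "d * d = b * b" for d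
  proof -
    have dw: "d * w = w * d" using d by (intro w(3)) (metis mult.assoc)
    have "positive_el (w - d)"
      by (rule positive_diff_of_square[OF positive_el_sa[OF d(1)] w(1) dw]) (simp add: d w(2))
    moreover have "positive_el (d - w)"
      by (rule positive_diff_of_square[OF positive_el_sa[OF w(1)] d(1) dw[symmetric]]) (simp add: d w(2))
    ultimately show ?thesis by (blast intro: positive_le_antisym)
  qed
  from *[OF b refl] *[OF c] eq show ?thesis by simp
qed

text \<open>\<open>b\<close> is the absolute value of \<open>y\<close>, so \<open>b + y\<close> and
  \<open>b - y\<close> are twice its positive and negative parts.\<close>

lemma abs_el_exists:
  fixes y :: "'a::cstar_algebra"
  assumes y: "self_adjoint y"
  obtains b where "positive_el b" "b * b = y * y" "positive_el (b - y)" "positive_el (b + y)"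
    "\<And>z. z * y = y * z \<Longrightarrow> z * b = b * z"
proof -
  obtain b where b: "positive_el b" "b * b = y * y" "\<And>z. z * (y * y) = (y * y) * z \<Longrightarrow> z * b = b * z"
    using positive_sqrt[OF positive_square[OF y]] by blast
  have comm: "z * b = b * z" if "z * y = y * z" for z
    using that by (intro b(3)) (metis mult.assoc)
  have yb: "y * b = b * y" by (intro comm) simp
  have "positive_el (b - y)"
    by (rule positive_diff_of_square[OF y b(1) yb]) (simp add: b(2))
  moreover have "positive_el (b - (- y))"
    by (rule positive_diff_of_square[OF sa_minus[OF y] b(1)]) (simp_all add: b(2) yb)
  then have "positive_el (b + y)" by simp
  ultimately show thesis by (rule that[OF b(1,2) _ _ comm])
qed

section \<open>Star homomorphisms\<close>

lemma star_hom_add: "unital_star_hom f \<Longrightarrow> f (x + y) = f x + f y"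
  and star_hom_scaleC: "unital_star_hom f \<Longrightarrow> f (c *\<^sub>C x) = c *\<^sub>C f x"
  and star_hom_mult: "unital_star_hom f \<Longrightarrow> f (x * y) = f x * f y"
  and star_hom_cstar: "unital_star_hom f \<Longrightarrow> f (cstar x) = cstar (f x)"
  and star_hom_1: "unital_star_hom f \<Longrightarrow> f 1 = 1"
  by (simp_all add: unital_star_hom_def)

lemma star_hom_scaleR: "unital_star_hom f \<Longrightarrow> f (r *\<^sub>R x) = r *\<^sub>R f x"
  by (simp add: scaleR_scaleC star_hom_scaleC)

lemma star_hom_0: "unital_star_hom f \<Longrightarrow> f 0 = 0"
  using star_hom_add[of f 0 0] by simp

lemma star_hom_diff: "unital_star_hom f \<Longrightarrow> f (x - y) = f x - f y"
  using star_hom_add[of f "x - y" y] by simp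

lemma star_hom_sum: "unital_star_hom f \<Longrightarrow> f (\<Sum>i\<in>I. g i) = (\<Sum>i\<in>I. f (g i))"
  by (induction I rule: infinite_finite_induct) (simp_all add: star_hom_add star_hom_0)

lemma star_hom_sa: "unital_star_hom f \<Longrightarrow> self_adjoint x \<Longrightarrow> self_adjoint (f x)"
  by (metis self_adjoint_def star_hom_cstar)

lemma star_hom_positive:
  assumes f: "unital_star_hom f" and a: "positive_el a"
  shows "positive_el (f a)"
proof -
  obtain b where "positive_el b" "b * b = a" using positive_sqrt[OF a] by blast
  then show ?thesis
    using positive_square[OF star_hom_sa[OF f positive_el_sa]] star_hom_mult[OF f] by metis
qed

text \<open>On self-adjoint elements the norm is determined by the order, which \<open>f\<close>
  preserves; the general case follows from the C*-identity for \<open>cstar x * x\<close>.\<close>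

lemma star_hom_norm_le:
  assumes f: "unital_star_hom f"
  shows "norm (f x) \<le> norm x"
proof -
  have sa: "norm (f a) \<le> norm a" if a: "self_adjoint a" for a
  proof (rule norm_le_iff_positive)
    show "self_adjoint (f a)" using star_hom_sa[OF f a] .
    show "positive_el (norm a *\<^sub>R 1 - f a)" "positive_el (norm a *\<^sub>R 1 + f a)"
      using star_hom_positive[OF f positive_bound(1)[OF a order_refl]]
        star_hom_positive[OF f positive_bound(2)[OF a order_refl]]
      by (simp_all add: star_hom_add[OF f] star_hom_diff[OF f] star_hom_scaleR[OF f] star_hom_1[OF f])
  qed simp
  have "self_adjoint (cstar x * x)" by (simp add: self_adjoint_def cstar_mult cstar_cstar)
  from sa[OF this] have "(norm (f x))\<^sup>2 \<le> (norm x)\<^sup>2"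
    by (simp add: star_hom_mult[OF f] star_hom_cstar[OF f] cstar_identity)
  then show ?thesis by (rule power2_le_imp_le) simp
qed

lemma star_hom_bounded_linear: "unital_star_hom f \<Longrightarrow> bounded_linear f"
  by (rule bounded_linear_intro[where K = 1])
    (simp_all add: star_hom_add star_hom_scaleR star_hom_norm_le)

section \<open>Density of invertible self-adjoint elements in commutants\<close>

definition commutant :: "'a::cstar_algebra set \<Rightarrow> 'a set" where
  "commutant Q = {x. \<forall>q\<in>Q. x * q = q * x}"

lemma commutantD: "x \<in> commutant Q \<Longrightarrow> q \<in> Q \<Longrightarrow> x * q = q * x"
  by (simp add: commutant_def)

lemma commutantI: "(\<And>q. q \<in> Q \<Longrightarrow> x * q = q * x) \<Longrightarrow> x \<in> commutant Q"
  by (simp add: commutant_def)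

lemma commutant_insert: "x \<in> commutant (insert q Q) \<longleftrightarrow> x * q = q * x \<and> x \<in> commutant Q"
  by (simp add: commutant_def)

lemma commutant_1: "1 \<in> commutant Q"
  and commutant_0: "0 \<in> commutant Q"
  and commutant_add: "x \<in> commutant Q \<Longrightarrow> y \<in> commutant Q \<Longrightarrow> x + y \<in> commutant Q"
  and commutant_diff: "x \<in> commutant Q \<Longrightarrow> y \<in> commutant Q \<Longrightarrow> x - y \<in> commutant Q"
  and commutant_scaleR: "x \<in> commutant Q \<Longrightarrow> r *\<^sub>R x \<in> commutant Q"
  by (auto simp: commutant_def algebra_simps)

lemma commutant_mult:
  assumes "x \<in> commutant Q" "y \<in> commutant Q" shows "x * y \<in> commutant Q"
proof (rule commutantI)
  fix q assume "q \<in> Q"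
  then show "x * y * q = q * (x * y)" using assms by (metis commutantD mult.assoc)
qed

lemmas commutant_intros = commutant_1 commutant_0 commutant_add commutant_diff commutant_scaleR
  commutant_mult

lemma commutant_inverse:
  assumes "x \<in> commutant Q" "x * y = 1" "y * x = 1" shows "y \<in> commutant Q"
  by (rule commutantI) (metis assms commutantD inverse_commute)

text \<open>For empty \<open>Q\<close> this is the Brown-Pedersen form of real rank zero. The
  relative form allows a projection to be lifted inside the commutant of the earlier lifts.\<close>

definition inv_dense :: "'a::cstar_algebra set \<Rightarrow> bool" where
  "inv_dense Q \<longleftrightarrow> (\<forall>x\<in>commutant Q. self_adjoint x \<longrightarrow> (\<forall>e>0. \<exists>y\<in>commutant Q.
     self_adjoint y \<and> invertible_el y \<and> norm (x - y) < e))"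

lemma inv_denseE:
  assumes "inv_dense Q" "x \<in> commutant Q" "self_adjoint x" "e > 0"
  obtains y z where "y \<in> commutant Q" "self_adjoint y" "y * z = 1" "z * y = 1" "norm (x - y) < e"
  using assms unfolding inv_dense_def invertible_el_def by metis

lemma norm_projection_le: "projection p \<Longrightarrow> norm p \<le> 1"
  using cstar_identity[of p] by (auto simp: projection_def power2_eq_square)

lemma norm_projection_eq: "projection p \<Longrightarrow> p \<noteq> 0 \<Longrightarrow> norm p = 1"
  using cstar_identity[of p] by (auto simp: projection_def power2_eq_square)

lemma projection_sa: "projection p \<Longrightarrow> self_adjoint p"
  and projection_idem: "projection p \<Longrightarrow> p * p = p"
  by (simp_all add: projection_def self_adjoint_def)

lemma projection_positive: "projection p \<Longrightarrow> positive_el p"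
  by (metis positive_square projection_idem projection_sa)

lemma projection_compl: "projection p \<Longrightarrow> projection (1 - p)"
  by (simp add: projection_def cstar_diff algebra_simps)

lemma projection_mult: "projection p \<Longrightarrow> projection q \<Longrightarrow> p * q = q * p \<Longrightarrow> projection (p * q)"
  unfolding projection_def by (simp add: cstar_mult) (metis mult.assoc)

lemma norm_sandwich_le:
  assumes "norm p \<le> 1" "norm q \<le> (1::real)"
  shows "norm (p * x * q) \<le> norm (x::'a::real_normed_algebra)"
proof -
  have "norm (p * x * q) \<le> norm p * norm x * norm q"
    by (meson norm_ge_zero norm_mult_ineq mult_right_mono order_trans)
  also have "\<dots> \<le> 1 * norm x * 1"
    using assms by (intro mult_mono) auto
  finally show ?thesis by simp
qed

text \<open>The Schur complement of an invertible approximation of \<open>q x q + (1 - q)\<close>.\<close>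
lemma inv_dense_corner:
  fixes q x :: "'a::cstar_algebra"
  assumes dens: "inv_dense Q" and q: "projection q" "q \<in> commutant Q"
    and x: "x \<in> commutant Q" "self_adjoint x" and e: "e > 0"
  obtains y where "y \<in> commutant Q" "self_adjoint y" "invertible_el y"
    "y = q * y * q + (1 - q)" "norm (q * x * q - q * y * q) < e"
proof -
  define p where "p = 1 - q"
  \<comment> \<open>\<open>d \<le> 1/2\<close> keeps the inverse \<open>v\<close> below norm 2; the
    final error is then at most \<open>2 * d\<close>.\<close>
  define d where "d = min (1/2) (e/4)"
  have d: "d > 0" "d \<le> 1/2" "2 * d < e" using e by (auto simp: d_def min_def)
  have p: "projection p" "p \<in> commutant Q"
    using q by (auto simp: p_def projection_compl intro: commutant_intros)
  have qp: "q + p = 1" "q * p = 0" "p * q = 0" "q * q = q" "p * p = p"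
    using q by (simp_all add: p_def algebra_simps projection_idem)
  have qpz: "q * (p * z) = 0" "p * (q * z) = 0" "q * (q * z) = q * z" "p * (p * z) = p * z" for z
    using qp by (simp_all flip: mult.assoc)
  have sq: "self_adjoint q" "self_adjoint p" using p q projection_sa by auto
  have nq: "norm q \<le> 1" "norm p \<le> 1" using p q norm_projection_le by auto
  define w where "w = q * x * q + p"
  have w: "w \<in> commutant Q" "self_adjoint w"
    unfolding w_def using x p q sq sa_sandwich[of x q]
    by (auto intro!: commutant_intros sa_intros simp: self_adjointD)
  obtain b c where b: "b \<in> commutant Q" "self_adjoint b" "b * c = 1" "c * b = 1" "norm (w - b) < d"
    using inv_denseE[OF dens w d(1)] .
  have c: "self_adjoint c" "c \<in> commutant Q"
    using b sa_inverse commutant_inverse by blast+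
  define u where "u = p * (w - b) * p"
  have u: "norm u \<le> d"
    unfolding u_def using norm_sandwich_le[OF nq(2,2), of "w - b"] b(5) by linarith
  have pwp: "p * w * p = p" "q * w * p = 0" "p * w * q = 0" "q * w * q = q * x * q"
    by (simp_all add: w_def algebra_simps qp qpz)
  \<comment> \<open>\<open>p * b * p\<close> is close to \<open>p * w * p = p\<close>, hence
    invertible in the corner of \<open>p\<close>; adding \<open>q\<close> makes it invertible in the
    whole algebra, with inverse \<open>v\<close>.\<close>
  have u1: "1 - u = q + p * b * p"
    using qp(1) pwp(1) by (simp add: u_def algebra_simps)
  have "norm (1 *\<^sub>R 1 - (1 - u)) < 1" using u d by simp
  then have "invertible_el (1 - u)" by (rule invertible_near_scalar)
  then obtain v where v: "(1 - u) * v = 1" "v * (1 - u) = 1" by (auto simp: invertible_el_def)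
  have "norm v \<le> 2"
  proof -
    have "v = 1 + u * v" using v(1) by (simp add: left_diff_distrib diff_eq_eq)
    then have "norm v \<le> 1 + norm u * norm v"
      by (metis norm_mult_ineq norm_one norm_triangle_mono order_refl)
    also have "\<dots> \<le> 1 + (1/2) * norm v"
      using u d by (intro add_left_mono mult_right_mono) auto
    finally show ?thesis by simp
  qed
  have up: "p * (1 - u) = (1 - u) * p" "p * (1 - u) = p * b * p" "(1 - u) \<in> commutant Q" "self_adjoint (1 - u)"
    unfolding u1 using b p q sq sa_sandwich[of b p]
    by (auto intro!: commutant_intros sa_intros simp: self_adjointD algebra_simps qp qpz)
  have vp: "p * v = v * p" using inverse_commute[OF v up(1)] .
  have v': "v \<in> commutant Q" "self_adjoint v"
    using commutant_inverse[OF up(3) v] sa_inverse[OF v up(4)] .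
  have vbp: "v * (p * b * p) = p" "(p * b * p) * v = p"
    using up(1,2) v vp by (metis mult.assoc mult_1_left mult_1_right)+
  \<comment> \<open>In blocks relative to \<open>q\<close> and \<open>p\<close>, \<open>y\<close> is
    the Schur complement of \<open>p * b * p\<close> in \<open>b\<close>, completed by
    \<open>p\<close>. Its inverse is the \<open>q\<close> block of the inverse \<open>c\<close> of
    \<open>b\<close>, completed by \<open>p\<close>.\<close>
  define y where "y = q * b * q - q * b * p * v * p * b * q + p"
  define z where "z = q * c * q + p"
  have y: "y \<in> commutant Q" "self_adjoint y"
  proof -
    show "y \<in> commutant Q" unfolding y_def
      by (intro commutant_intros b p q v')
    show "self_adjoint y" unfolding y_def self_adjoint_def
      using sq b(2) v'(2) by (simp add: self_adjoint_def cstar_add cstar_diff cstar_mult mult.assoc)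
  qed
  \<comment> \<open>This is the lower left block of the equation \<open>b * c = 1\<close>.\<close>
  have "p * b * q * c * q = - (p * b * p * c * q)"
  proof -
    have "p * b * (q + p) * c * q = 0" using b(3) qp by (simp add: mult.assoc)
    then show ?thesis by (simp add: algebra_simps eq_neg_iff_add_eq_0)
  qed
  then have "q * b * (v * (p * b * q * c * q)) = - (q * b * (v * (p * b * p)) * c * q)"
    by (simp add: mult.assoc)
  then have 1: "q * b * (v * (p * b * q * c * q)) = - (q * b * p * c * q)"
    unfolding vbp .
  have "y * z = q * b * q * c * q - q * b * (p * v) * p * b * q * c * q + p"
    by (simp add: y_def z_def algebra_simps qp qpz)
  also have "q * b * (p * v) * p * b * q * c * q = q * b * (v * (p * b * q * c * q))"
    by (simp add: vp mult.assoc qpz)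
  also have "q * b * q * c * q - q * b * (v * (p * b * q * c * q)) + p = q * (b * (q + p) * c) * q + p"
    unfolding 1 by (simp add: algebra_simps)
  also have "\<dots> = 1" using b(3) qp by simp
  finally have yz: "y * z = 1" .
  have "self_adjoint z" unfolding z_def using c sq sa_sandwich[of c q]
    by (auto intro!: sa_intros simp: self_adjointD)
  then have "z * y = 1"
    using arg_cong[OF yz, of cstar] y(2) by (simp add: cstar_mult self_adjoint_def)
  with yz have inv: "invertible_el y" by (auto simp: invertible_el_def)
  have qyq: "q * y * q = q * b * q - q * b * p * v * p * b * q"
    by (simp add: y_def algebra_simps qp qpz)
  \<comment> \<open>\<open>w\<close> is block diagonal, so the off-diagonal blocks of
    \<open>b\<close> are those of \<open>b - w\<close> and have norm at most
    \<open>d\<close>.\<close>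
  have bqp: "q * b * p = q * (b - w) * p" "p * b * q = p * (b - w) * q"
    by (simp_all add: right_diff_distrib left_diff_distrib pwp)
  have nb: "norm (b - w) < d" using b(5) by (simp add: norm_minus_commute)
  have n2: "norm (q * b * p) \<le> d" "norm (p * b * q) \<le> d"
    unfolding bqp using norm_sandwich_le[OF nq, of "b - w"] norm_sandwich_le[OF nq(2,1), of "b - w"] nb
    by linarith+
  have "q * x * q - q * y * q = q * (w - b) * q + (q * b * p) * v * (p * b * q)"
    unfolding qyq pwp(4)[symmetric] by (simp add: algebra_simps)
  then have "norm (q * x * q - q * y * q) \<le> norm (q * (w - b) * q) + norm ((q * b * p) * v * (p * b * q))"
    by (simp add: norm_triangle_ineq)
  moreover have "norm (q * (w - b) * q) < d"
    using norm_sandwich_le[OF nq(1,1), of "w - b"] b(5) by linarith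
  moreover have "norm ((q * b * p) * v * (p * b * q)) \<le> d * 2 * (1/2)"
  proof -
    have "norm ((q * b * p) * v * (p * b * q)) \<le> norm (q * b * p) * norm v * norm (p * b * q)"
      by (meson norm_ge_zero norm_mult_ineq mult_right_mono order_trans)
    also have "\<dots> \<le> d * 2 * (1/2)"
      using n2 \<open>norm v \<le> 2\<close> d by (intro mult_mono) auto
    finally show ?thesis .
  qed
  ultimately have "norm (q * x * q - q * y * q) < e" using d by linarith
  moreover have "y = q * y * q + (1 - q)" unfolding qyq by (simp add: y_def p_def)
  ultimately show thesis using that y inv by blast
qed

text \<open>An element commuting with \<open>q\<close> is block diagonal. Each block is approximated
  inside its corner and padded by the unit of the other; the product of the padded elements
  \<open>s + p\<close> and \<open>t + q\<close> is \<open>s + t\<close>.\<close>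

lemma inv_dense_insert:
  assumes dens: "inv_dense Q" and q: "projection q" "q \<in> commutant Q"
  shows "inv_dense (insert q Q)"
  unfolding inv_dense_def
proof (intro ballI impI allI)
  fix x and e :: real
  assume x: "x \<in> commutant (insert q Q)" "self_adjoint x" and e: "e > 0"
  define p where "p = 1 - q"
  have qp: "q * p = 0" "p * q = 0" "q * q = q" "p * p = p"
    using q by (simp_all add: p_def algebra_simps projection_idem)
  have qpz: "q * (p * z) = 0" "p * (q * z) = 0" "q * (q * z) = q * z" "p * (p * z) = p * z" for z
    using qp by (simp_all flip: mult.assoc)
  have x': "x \<in> commutant Q" "x * q = q * x" using x by (auto simp: commutant_insert)
  obtain y where y: "y \<in> commutant Q" "self_adjoint y" "invertible_el y" "y = q * y * q + (1 - q)"
      "norm (q * x * q - q * y * q) < e / 2"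
    using inv_dense_corner[OF dens q x'(1) x(2), of "e/2"] e by auto
  have p: "projection p" "p \<in> commutant Q"
    using q by (auto simp: p_def projection_compl intro: commutant_intros)
  obtain z where z: "z \<in> commutant Q" "self_adjoint z" "invertible_el z" "z = p * z * p + (1 - p)"
      "norm (p * x * p - p * z * p) < e / 2"
    using inv_dense_corner[OF dens p x'(1) x(2), of "e/2"] e by auto
  have y4: "y = q * y * q + p" and z4: "z = p * z * p + q"
    using y(4) z(4) by (simp_all add: p_def)
  define s t where "s = q * y * q" and "t = p * z * p"
  have st: "s * t = 0" "t * s = 0" "q * s = s" "s * q = s" "p * t = t" "t * p = t"
    "q * t = 0" "t * q = 0" "p * s = 0" "s * p = 0"
    by (simp_all add: s_def t_def mult.assoc qp qpz)
  have yst: "y = s + p" "z = t + q" using y4 z4 by (simp_all add: s_def t_def)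
  have yz: "y * z = s + t" "z * y = s + t"
    by (simp_all add: yst algebra_simps st qp)
  have "y * q = q * y" "z * q = q * z" by (simp_all add: yst algebra_simps st qp)
  then have "y * z \<in> commutant (insert q Q)"
    using y(1) z(1) by (intro commutant_mult) (simp_all add: commutant_insert)
  moreover have "self_adjoint (y * z)" using y z yz by (intro sa_mult) auto
  moreover have "invertible_el (y * z)"
    using y(3) z(3) unfolding invertible_el_def by (metis mult.assoc mult_1_left)
  moreover have "norm (x - y * z) < e"
  proof -
    have "x * p = p * x" using x'(2) by (simp add: p_def algebra_simps)
    then have "q * x * q = q * x" "p * x * p = p * x"
      using x'(2) by (simp_all add: mult.assoc qpz)
    then have "x = q * x * q + p * x * p" by (simp only:) (simp add: p_def algebra_simps)
    then have "x - y * z = (q * x * q - s) + (p * x * p - t)" by (simp add: yz)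
    then show ?thesis
      using norm_triangle_ineq[of "q * x * q - s" "p * x * p - t"] y(5) z(5) by (simp add: s_def t_def)
  qed
  ultimately show "\<exists>y\<in>commutant (insert q Q). self_adjoint y \<and> invertible_el y \<and> norm (x - y) < e"
    by blast
qed

lemma inv_dense_finite:
  assumes dens: "inv_dense ({}::'a::cstar_algebra set)"
    and "finite Q" "\<And>q. q \<in> Q \<Longrightarrow> projection q" "\<And>p q. p \<in> Q \<Longrightarrow> q \<in> Q \<Longrightarrow> p * q = q * p"
  shows "inv_dense (Q :: 'a set)"
  using assms(2-4)
proof (induction Q)
  case (insert q Q)
  then show ?case by (intro inv_dense_insert) (auto intro: commutantI)
qed (use dens in simp)

text \<open>An approximant \<open>y\<close> with finite spectrum becomes invertible after adding a
  suitable, arbitrarily small, positive scalar.\<close>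

lemma real_rank_zero_inv_dense:
  assumes "real_rank_zero TYPE('a::cstar_algebra)"
  shows "inv_dense ({}::'a set)"
  unfolding inv_dense_def
proof (intro ballI impI allI)
  fix x :: 'a and e :: real
  assume x: "self_adjoint x" and e: "e > 0"
  have "x \<in> closure {y. self_adjoint y \<and> finite (spectrum y)}"
    using assms x by (simp add: real_rank_zero_def)
  then obtain y where y: "self_adjoint y" "finite (spectrum y)" "dist y x < e / 2"
    using e unfolding closure_approachable by (metis (mono_tags, lifting) half_gt_zero mem_Collect_eq)
  have "infinite ((\<lambda>r. complex_of_real (- r)) ` {0<..<e/2})"
    using e by (subst finite_image_iff) (auto simp: inj_on_def infinite_Ioo)
  then have "\<not> (\<lambda>r. complex_of_real (- r)) ` {0<..<e/2} \<subseteq> spectrum y"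
    using y(2) finite_subset by blast
  then obtain r where "r \<in> {0<..<e/2}" and r': "complex_of_real (- r) \<notin> spectrum y" by blast
  then have r: "0 < r" "r < e/2" "complex_of_real (- r) \<notin> spectrum y" by auto
  have "invertible_el (y + r *\<^sub>R 1)" using r(3) by (simp add: spectrum_def scaleR_scaleC)
  moreover have "norm (x - (y + r *\<^sub>R 1)) < e"
    using norm_triangle_ineq4[of "x - y" "r *\<^sub>R 1"] y(3) r
    by (simp add: dist_norm norm_minus_commute algebra_simps)
  moreover have "self_adjoint (y + r *\<^sub>R 1)" by (intro sa_intros y)
  ultimately show "\<exists>y\<in>commutant {}. self_adjoint y \<and> invertible_el y \<and> norm (x - y) < e"
    by (auto simp: commutant_def)
qed

section \<open>Lifting projections\<close>

text \<open>Polar decomposition: \<open>b\<close> is the absolute value of \<open>y\<close> and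
  \<open>q\<close> its sign, taken inside every commutant that contains \<open>y\<close>.\<close>

lemma sign_el_exists:
  fixes y :: "'a::cstar_algebra"
  assumes y: "self_adjoint y" and "y * z = 1" "z * y = 1"
  obtains b q where "positive_el b" "b * b = y * y" "q = z * b" "self_adjoint q" "q * q = 1"
    "q * y = b" "y * q = b" "\<And>Q. y \<in> commutant Q \<Longrightarrow> q \<in> commutant Q"
proof -
  obtain b where b: "positive_el b" "b * b = y * y" "\<And>z. z * y = y * z \<Longrightarrow> z * b = b * z"
    using abs_el_exists[OF y] by metis
  have zb: "z * b = b * z" using assms by (intro b(3)) simp
  have yb: "y * b = b * y" by (intro b(3)) simp
  have "self_adjoint (z * b)"
    using sa_inverse[OF assms(2,3,1)] positive_el_sa[OF b(1)] zb by (intro sa_mult)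
  moreover have "(z * b) * (z * b) = z * (b * b) * z" using zb by (metis mult.assoc)
  then have "(z * b) * (z * b) = 1" using assms by (simp add: b(2) mult.assoc)
  moreover have "(z * b) * y = b" "y * (z * b) = b"
    using assms yb by (metis mult.assoc mult_1_left)+
  moreover have "z * b \<in> commutant Q" if "y \<in> commutant Q" for Q
  proof (rule commutant_mult)
    show "z \<in> commutant Q" using commutant_inverse[OF that assms(2,3)] .
    show "b \<in> commutant Q" using that b(3) by (auto simp: commutant_def)
  qed
  ultimately show thesis using that b by blast
qed

lemma norm_symmetry: "self_adjoint s \<Longrightarrow> s * s = 1 \<Longrightarrow> norm (s::'a::cstar_algebra) = 1"
  using norm_sa_square[of s] norm_ge_zero[of s] by (auto simp: power2_eq_1_iff simp del: norm_ge_zero)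

text \<open>Let \<open>q\<close> be the sign of an invertible \<open>y\<close> close to \<open>x\<close>, and \<open>r = \<pi> q\<close>, \<open>\<sigma> = \<pi> x\<close>. Then
  \<open>q + x q x\<close> is invertible and is mapped to \<open>r + \<sigma> r \<sigma> = \<sigma> (r \<sigma> + \<sigma> r)\<close>; here \<open>r \<sigma> + \<sigma> r\<close> is
  positive and commutes with \<open>\<sigma>\<close>, so the sign of \<open>q + x q x\<close> is mapped to \<open>\<sigma>\<close>.\<close>
lemma lift_symmetry:
  fixes \<pi> :: "'b::cstar_algebra \<Rightarrow> 'm::cstar_algebra"
  assumes hom: "unital_star_hom \<pi>" and dens: "inv_dense Q"
    and x: "x \<in> commutant Q" "self_adjoint x" and sym: "\<pi> x * \<pi> x = 1"
  obtains s where "s \<in> commutant Q" "self_adjoint s" "s * s = 1" "\<pi> s = \<pi> x"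
proof -
  \<comment> \<open>So small that exchanging \<open>x\<close> for \<open>y\<close> costs less than 1
    in the invertibility of \<open>V\<close>, and that the estimate of \<open>g\<close> in the
    positivity of \<open>T\<close> closes.\<close>
  define \<delta> where "\<delta> = 1 / (8 * (norm x + 1))"
  have n: "norm x + 1 > 0" by (simp add: add_nonneg_pos)
  have \<delta>: "\<delta> > 0" "\<delta> \<le> 1/8" "\<delta> * (2 * norm x + 1) < 1"
    using n by (auto simp: \<delta>_def divide_simps)
  obtain y yi where y: "y \<in> commutant Q" "self_adjoint y" "y * yi = 1" "yi * y = 1" "norm (x - y) < \<delta>"
    using inv_denseE[OF dens x \<delta>(1)] .
  obtain b q where q: "positive_el b" "b * b = y * y" "self_adjoint q" "q * q = 1" "q * y = b" "y * q = b"
      "q \<in> commutant Q"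
    using sign_el_exists[OF y(2-4)] y(1) by metis
  have nq: "norm q = 1" using q norm_symmetry by blast
  define V where "V = q + x * q * x"
  have V: "V \<in> commutant Q" "self_adjoint V"
    unfolding V_def using sa_sandwich[OF q(3), of x] x q
    by (auto intro!: commutant_intros sa_intros simp: self_adjointD)
  have "invertible_el V"
  proof -
    \<comment> \<open>\<open>h\<close> is x q x - y q y. Since q y q y = y y, the element
      \<open>q * V\<close> is 1 + y y + q h, a small perturbation of an element above 1.\<close>
    define h where "h = (x - y) * q * x + y * q * (x - y)"
    have "norm y \<le> norm x + 1"
      using norm_triangle_ineq2[of y x] y(5) \<delta>(2) by (simp add: norm_minus_commute)
    have "norm h \<le> norm (x - y) * norm q * norm x + norm y * norm q * norm (x - y)"
      unfolding h_def
      by (intro norm_triangle_mono) (meson norm_ge_zero norm_mult_ineq mult_right_mono order_trans)+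
    also have "\<dots> = norm (x - y) * (norm x + norm y)" using nq by (simp add: algebra_simps)
    also have "\<dots> \<le> \<delta> * (2 * norm x + 1)"
      using y(5) \<delta>(1) \<open>norm y \<le> norm x + 1\<close> by (intro mult_mono) auto
    finally have "norm h < 1" using \<delta> by linarith
    then have "norm (q * h) < 1" using norm_mult_ineq[of q h] nq by simp
    then have "invertible_el (y * y + 1 *\<^sub>R 1 + q * h)"
      using positive_square[OF y(2)] by (intro invertible_positive_plus)
    moreover have "y * y + 1 *\<^sub>R 1 + q * h = q * V"
    proof -
      have "q * (y * q * y) = y * y"
        using q(4-6) by (metis mult.assoc mult_1_left)
      moreover have "h = x * q * x - y * q * y" by (simp add: h_def algebra_simps)
      ultimately have "q * h = q * (x * q * x) - y * y" by (simp only: right_diff_distrib)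
      then show ?thesis using q(4) by (simp add: V_def distrib_left)
    qed
    ultimately obtain c where c: "q * V * c = 1" "c * (q * V) = 1" by (auto simp: invertible_el_def)
    have "V * (c * q) = q * (q * V * c) * q" using q(4) by (metis mult.assoc mult_1_left)
    then have "V * (c * q) = 1" using c q(4) by simp
    moreover have "(c * q) * V = 1" using c by (simp add: mult.assoc)
    ultimately show ?thesis unfolding invertible_el_def by blast
  qed
  then obtain Vi where Vi: "V * Vi = 1" "Vi * V = 1" by (auto simp: invertible_el_def)
  obtain B s where B: "positive_el B" "B * B = V * V" and s: "s = Vi * B" "self_adjoint s" "s * s = 1"
      "s \<in> commutant Q"
    using sign_el_exists[OF V(2) Vi] V(1) by metis
  note h = star_hom_add[OF hom] star_hom_mult[OF hom] star_hom_1[OF hom] star_hom_diff[OF hom]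
  define r \<sigma> \<beta> \<eta> where "r = \<pi> q" and "\<sigma> = \<pi> x" and "\<beta> = \<pi> b" and "\<eta> = \<pi> x - \<pi> y"
  define T where "T = r * \<sigma> + \<sigma> * r"
  have sa: "self_adjoint r" "self_adjoint \<sigma>" "self_adjoint \<eta>"
    using q x y by (auto simp: r_def \<sigma>_def \<eta>_def intro!: star_hom_sa[OF hom] sa_intros)
  have rr: "r * r = 1" and \<sigma>\<sigma>: "\<sigma> * \<sigma> = 1"
    using sym by (simp_all only: r_def \<sigma>_def h(2)[symmetric] q(4) h(3))
  have n1: "norm r = 1" "norm \<sigma> = 1" using sa rr \<sigma>\<sigma> norm_symmetry by auto
  have \<eta>: "norm \<eta> \<le> \<delta>"
    using star_hom_norm_le[OF hom, of "x - y"] y(5) by (simp add: \<eta>_def h)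
  have T: "positive_el T"
  proof -
    have y': "\<pi> y = \<sigma> - \<eta>" by (simp add: \<sigma>_def \<eta>_def)
    have ry: "r * \<pi> y = \<beta>" "\<pi> y * r = \<beta>"
      by (simp_all only: r_def \<beta>_def h(2)[symmetric] q(5,6))
    \<comment> \<open>The square of \<beta> is that of \<open>\<sigma> - \<eta>\<close>, which is 1
      + g because \<open>\<sigma> * \<sigma> = 1\<close>. As \<open>g\<close> is small, comparing
      squares yields \<beta> \<ge> \<delta>.\<close>
    define g where "g = \<eta> * \<eta> - (\<sigma> * \<eta> + \<eta> * \<sigma>)"
    have comm_sum: "self_adjoint (a * c + c * a)" if "self_adjoint a" "self_adjoint c" for a c :: 'm
      using that by (simp add: self_adjoint_def cstar_add cstar_mult add.commute)
    have nprod: "norm (a * c + c * a) \<le> 2 * \<delta>" if "norm a = 1" "norm c \<le> \<delta>" for a c :: 'm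
      using norm_triangle_ineq[of "a * c" "c * a"] norm_mult_ineq[of a c] norm_mult_ineq[of c a] that by simp
    have "norm (\<eta> * \<eta>) \<le> \<delta> * \<delta>"
      using norm_mult_ineq[of \<eta> \<eta>] \<eta> by (meson mult_mono norm_ge_zero order_trans)
    then have "norm g \<le> \<delta> * \<delta> + 2 * \<delta>"
      unfolding g_def using nprod[OF n1(2) \<eta>] norm_triangle_ineq4[of "\<eta> * \<eta>" "\<sigma> * \<eta> + \<eta> * \<sigma>"] by linarith
    moreover have "\<delta> * \<delta> \<le> (1/8) * (1/8)" using \<delta> by (intro mult_mono) auto
    ultimately have "norm g \<le> 1 - \<delta> * \<delta>" using \<delta> by simp
    then have "positive_el ((1 - \<delta> * \<delta>) *\<^sub>R 1 + g)"
      by (intro positive_bound) (simp_all add: g_def sa sa_diff sa_square comm_sum)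
    moreover have "\<beta> * \<beta> = \<pi> y * \<pi> y"
      by (simp only: \<beta>_def h(2)[symmetric] q(2))
    then have "\<beta> * \<beta> - (\<delta> *\<^sub>R 1) * (\<delta> *\<^sub>R 1) = (1 - \<delta> * \<delta>) *\<^sub>R 1 + g"
      by (simp add: y' g_def algebra_simps \<sigma>\<sigma>)
    ultimately have sq: "positive_el (\<beta> * \<beta> - (\<delta> *\<^sub>R 1) * (\<delta> *\<^sub>R 1))" by simp
    have "positive_el \<beta>" unfolding \<beta>_def by (rule star_hom_positive[OF hom q(1)])
    then have "positive_el (\<beta> - \<delta> *\<^sub>R 1)"
      by (rule positive_diff_of_square[OF sa_scaleR[OF sa_1] _ _ sq]) simp
    then have "positive_el (2 *\<^sub>R (\<beta> - \<delta> *\<^sub>R 1))" by (rule positive_scaleR) simp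
    \<comment> \<open>As \<open>\<pi> y\<close> times \<open>r\<close> is \<beta> on either side,
      \<open>T\<close> is 2 \<beta> plus \<open>r * \<eta> + \<eta> * r\<close>, and the latter is
      at least -2 \<delta>.\<close>
    moreover have "positive_el ((2 * \<delta>) *\<^sub>R 1 + (r * \<eta> + \<eta> * r))"
      by (intro positive_bound nprod comm_sum sa n1 \<eta>)
    ultimately have "positive_el (2 *\<^sub>R (\<beta> - \<delta> *\<^sub>R 1) + ((2 * \<delta>) *\<^sub>R 1 + (r * \<eta> + \<eta> * r)))"
      by (rule positive_add)
    moreover have "\<sigma> = \<pi> y + \<eta>" by (simp add: y')
    then have "T = 2 *\<^sub>R (\<beta> - \<delta> *\<^sub>R 1) + ((2 * \<delta>) *\<^sub>R 1 + (r * \<eta> + \<eta> * r))"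
      by (simp add: T_def algebra_simps ry scaleR_2)
    ultimately show ?thesis by simp
  qed
  have \<pi>V: "\<pi> V = \<sigma> * T" "\<pi> V = T * \<sigma>"
  proof -
    have "\<pi> V = r + \<sigma> * r * \<sigma>" by (simp add: V_def h r_def \<sigma>_def)
    moreover have "\<sigma> * (\<sigma> * r) = r" using \<sigma>\<sigma> by (simp flip: mult.assoc)
    ultimately show "\<pi> V = \<sigma> * T" "\<pi> V = T * \<sigma>"
      by (simp_all add: T_def distrib_left distrib_right mult.assoc \<sigma>\<sigma> add.commute)
  qed
  \<comment> \<open>\<open>T\<close> and \<open>\<pi> B\<close> are both positive roots of the
    square of \<open>\<pi> V\<close>, hence equal; cancelling \<open>\<pi> V\<close> then leaves
    \<sigma>.\<close>
  then have "\<pi> V * \<pi> V = T * T" using \<sigma>\<sigma> by (metis mult.assoc mult_1_left mult_1_right)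
  moreover have "\<pi> B * \<pi> B = \<pi> V * \<pi> V" by (simp only: h(2)[symmetric] B(2))
  ultimately have "\<pi> B = T"
    using positive_sqrt_unique[OF star_hom_positive[OF hom B(1)] T] by simp
  then have "\<pi> s = \<pi> Vi * (\<pi> V * \<sigma>)"
    unfolding \<pi>V(2) using \<sigma>\<sigma> by (simp add: s(1) h mult.assoc)
  also have "\<dots> = \<sigma>" using Vi(2) h(2,3) by (metis mult.assoc mult_1_left)
  finally show thesis using that s by (simp add: \<sigma>_def)
qed

text \<open>The family \<open>A\<close> consists of the atoms of a finite Boolean algebra of projections on which
  \<open>\<pi>\<close> is injective.\<close>
definition atom_family :: "('b::cstar_algebra \<Rightarrow> 'm::cstar_algebra) \<Rightarrow> 'b set \<Rightarrow> bool" where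
  "atom_family \<pi> A \<longleftrightarrow> finite A \<and> (\<forall>e\<in>A. projection e \<and> \<pi> e \<noteq> 0) \<and>
     (\<forall>e\<in>A. \<forall>f\<in>A. e \<noteq> f \<longrightarrow> e * f = 0) \<and> \<Sum>A = 1"

section \<open>Complex linear spans and the subalgebras they form\<close>

inductive_set cspan :: "'a::cstar_algebra set \<Rightarrow> 'a set" for S where
  cspan_0: "0 \<in> cspan S"
| cspan_add: "x \<in> cspan S \<Longrightarrow> y \<in> cspan S \<Longrightarrow> x + y \<in> cspan S"
| cspan_base_scaleC: "x \<in> S \<Longrightarrow> c *\<^sub>C x \<in> cspan S"

lemma cspan_base: "x \<in> S \<Longrightarrow> x \<in> cspan S"
  using cspan_base_scaleC[of x S 1] by (simp add: scaleC_one)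

lemma cspan_scaleC: "x \<in> cspan S \<Longrightarrow> c *\<^sub>C x \<in> cspan S"
  by (induction rule: cspan.induct) (auto intro: cspan.intros simp: scaleC_add_right scaleC_scaleC)

lemma cspan_diff: "x \<in> cspan S \<Longrightarrow> y \<in> cspan S \<Longrightarrow> x - y \<in> cspan S"
  using cspan_add[of x S "(- 1) *\<^sub>C y"] cspan_scaleC[of y S "- 1"] by (simp add: scaleC_one)

lemma cspan_sum: "(\<And>i. i \<in> I \<Longrightarrow> f i \<in> cspan S) \<Longrightarrow> (\<Sum>i\<in>I. f i) \<in> cspan S"
  by (induction I rule: infinite_finite_induct) (auto intro: cspan.intros)

lemma cspan_subset: "S \<subseteq> cspan T \<Longrightarrow> cspan S \<subseteq> cspan T"
proof
  fix x assume "x \<in> cspan S" "S \<subseteq> cspan T"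
  then show "x \<in> cspan T"
    by induction (auto intro: cspan_0 cspan_add cspan_scaleC)
qed

lemma cspan_mono: "S \<subseteq> T \<Longrightarrow> cspan S \<subseteq> cspan T"
  by (rule cspan_subset) (auto intro: cspan_base)

lemma cspan_mult:
  assumes "\<And>x y. x \<in> S \<Longrightarrow> y \<in> S \<Longrightarrow> x * y \<in> cspan S" "x \<in> cspan S" "y \<in> cspan S"
  shows "x * y \<in> cspan S"
  using assms(2)
proof induction
  case (cspan_base_scaleC x c)
  have "x * y \<in> cspan S" using assms(3)
    by induction (auto intro: cspan.intros assms(1) cspan_base_scaleC cspan_scaleC
        simp: distrib_left mult_scaleC_right)
  then show ?case by (simp add: mult_scaleC_left cspan_scaleC)
qed (auto intro: cspan.intros simp: distrib_right)

lemma cspan_cstar: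
  assumes "\<And>x. x \<in> S \<Longrightarrow> self_adjoint x" "x \<in> cspan S" shows "cstar x \<in> cspan S"
  using assms(2)
  by induction (auto intro: cspan.intros simp: assms(1) cstar_add cstar_scaleC self_adjointD)

lemma star_subalgebra_cspan:
  assumes "\<And>x. x \<in> S \<Longrightarrow> self_adjoint x" "\<And>x y. x \<in> S \<Longrightarrow> y \<in> S \<Longrightarrow> x * y \<in> cspan S"
  shows "star_subalgebra (cspan S)"
  unfolding star_subalgebra_def
  using assms by (auto intro: cspan_0 cspan_add cspan_scaleC cspan_cstar cspan_mult)

lemma star_subalgebra_cspan_projections:
  assumes "star_subalgebra C" "abelian_set C"
  shows "star_subalgebra (cspan {p \<in> C. projection p})"
proof (rule star_subalgebra_cspan)
  fix p q assume pq: "p \<in> {p \<in> C. projection p}" "q \<in> {p \<in> C. projection p}"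
  then have "p * q = q * p" "p * q \<in> C"
    using assms by (auto simp: abelian_set_def star_subalgebra_def)
  then have "p * q \<in> {p \<in> C. projection p}" using projection_mult[of p q] pq by blast
  then show "p * q \<in> cspan {p \<in> C. projection p}" by (rule cspan_base)
qed (auto intro: projection_sa)

lemma cspan_finite_subset: "x \<in> cspan S \<Longrightarrow> \<exists>T. finite T \<and> T \<subseteq> S \<and> x \<in> cspan T"
proof (induction rule: cspan.induct)
  case (cspan_add x y)
  then obtain T U where "finite T" "T \<subseteq> S" "x \<in> cspan T" "finite U" "U \<subseteq> S" "y \<in> cspan U" by blast
  then show ?case
    using cspan_mono[of T "T \<union> U"] cspan_mono[of U "T \<union> U"]
    by (intro exI[of _ "T \<union> U"]) (auto intro: cspan.cspan_add)
next
  case (cspan_base_scaleC x c)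
  then show ?case by (intro exI[of _ "{x}"]) (auto intro: cspan.intros)
qed (auto intro: cspan_0)

lemma cspan_image:
  assumes f: "unital_star_hom f" and "S \<subseteq> f ` cspan T"
  shows "cspan S \<subseteq> f ` cspan T"
proof
  fix x assume "x \<in> cspan S"
  then show "x \<in> f ` cspan T"
  proof induction
    case cspan_0
    show ?case using star_hom_0[OF f] cspan.cspan_0 by (metis image_eqI)
  next
    case (cspan_add x y)
    then show ?case using star_hom_add[OF f] cspan.cspan_add by (smt (verit) image_iff)
  next
    case (cspan_base_scaleC x c)
    then obtain y where "y \<in> cspan T" "x = f y" using assms(2) by blast
    then show ?case using star_hom_scaleC[OF f] cspan_scaleC by (metis image_eqI)
  qed
qed

lemma cspan_finite_sum:
  assumes "finite A" "x \<in> cspan A"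
  obtains c where "x = (\<Sum>e\<in>A. c e *\<^sub>C e)"
proof -
  have "\<exists>c. x = (\<Sum>e\<in>A. c e *\<^sub>C e)" using assms(2)
  proof induction
    case cspan_0
    show ?case by (intro exI[of _ "\<lambda>_. 0"]) simp
  next
    case (cspan_add x y)
    then obtain c d where "x = (\<Sum>e\<in>A. c e *\<^sub>C e)" "y = (\<Sum>e\<in>A. d e *\<^sub>C e)" by blast
    then show ?case
      by (intro exI[of _ "\<lambda>e. c e + d e"]) (simp add: scaleC_add_left sum.distrib)
  next
    case (cspan_base_scaleC x c)
    have "(\<Sum>e\<in>A. (if e = x then c else 0) *\<^sub>C e) = (\<Sum>e\<in>A. if e = x then c *\<^sub>C x else 0)"
      by (rule sum.cong) auto
    then show ?case
      using cspan_base_scaleC assms(1) by (intro exI[of _ "\<lambda>e. if e = x then c else 0"]) simp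
  qed
  then show thesis using that by blast
qed

lemma star_subalgebra_closure:
  assumes C: "star_subalgebra C" shows "star_subalgebra (closure C)"
proof -
  have seq: "\<exists>f. (\<forall>n. f n \<in> C) \<and> f \<longlonglongrightarrow> x" if "x \<in> closure C" for x
    using that by (simp add: closure_sequential)
  have lim: "l \<in> closure C" if "\<And>n. h n \<in> C" "h \<longlonglongrightarrow> l" for h l
    unfolding closure_sequential using that by blast
  show ?thesis
    unfolding star_subalgebra_def
  proof (intro conjI ballI allI)
    show "0 \<in> closure C" using C closure_subset by (auto simp: star_subalgebra_def)
  next
    fix x y assume "x \<in> closure C" "y \<in> closure C"
    then obtain f g where fg: "\<And>n. f n \<in> C" "f \<longlonglongrightarrow> x" "\<And>n. g n \<in> C" "g \<longlonglongrightarrow> y"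
      using seq by metis
    show "x + y \<in> closure C"
      by (rule lim[OF _ tendsto_add[OF fg(2,4)]]) (use C fg in \<open>simp add: star_subalgebra_def\<close>)
    show "x * y \<in> closure C"
      by (rule lim[OF _ tendsto_mult[OF fg(2,4)]]) (use C fg in \<open>simp add: star_subalgebra_def\<close>)
  next
    fix x c assume "x \<in> closure C"
    then obtain f where f: "\<And>n. f n \<in> C" "f \<longlonglongrightarrow> x" using seq by metis
    show "c *\<^sub>C x \<in> closure C"
      by (rule lim[OF _ bounded_linear.tendsto[OF bounded_linear_scaleC f(2)]])
        (use C f in \<open>simp add: star_subalgebra_def\<close>)
    show "cstar x \<in> closure C"
      by (rule lim[OF _ bounded_linear.tendsto[OF bounded_linear_cstar f(2)]])
        (use C f in \<open>simp add: star_subalgebra_def\<close>)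
  qed
qed

lemma atom_familyD:
  assumes "atom_family \<pi> A"
  shows "finite A" "e \<in> A \<Longrightarrow> projection e" "e \<in> A \<Longrightarrow> \<pi> e \<noteq> 0"
    "e \<in> A \<Longrightarrow> f \<in> A \<Longrightarrow> e \<noteq> f \<Longrightarrow> e * f = 0" "\<Sum>A = 1"
  using assms by (auto simp: atom_family_def)

lemma atom_family_mult:
  "atom_family \<pi> A \<Longrightarrow> e \<in> A \<Longrightarrow> f \<in> A \<Longrightarrow> e * f = (if e = f then e else 0)"
  by (simp add: atom_familyD projection_idem)

lemma star_hom_projection: "unital_star_hom f \<Longrightarrow> projection p \<Longrightarrow> projection (f p)"
  unfolding projection_def by (metis star_hom_cstar star_hom_mult)

text \<open>The coefficients of \<open>x\<close> can be read off its image: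
  \<open>\<pi> x * \<pi> f = c f *\<^sub>C \<pi> f\<close>, and the nonzero projection
  \<open>\<pi> f\<close> has norm 1. So they are bounded by \<open>norm (\<pi> x)\<close>, which
  bounds \<open>cstar x * x\<close>, the combination of the atoms with the squared moduli.\<close>

lemma atom_family_isometric:
  assumes hom: "unital_star_hom \<pi>" and A: "atom_family \<pi> A" and x: "x \<in> cspan A"
  shows "norm (\<pi> x) = norm x"
proof (rule antisym)
  show "norm (\<pi> x) \<le> norm x" by (rule star_hom_norm_le[OF hom])
  obtain c where c: "x = (\<Sum>e\<in>A. c e *\<^sub>C e)" using cspan_finite_sum[OF atom_familyD(1)[OF A] x] .
  define K where "K = norm (\<pi> x)"
  have sum_A: "(\<Sum>e\<in>A. g e *\<^sub>C e) * f = g f *\<^sub>C f" if "f \<in> A" for f g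
  proof -
    have "(\<Sum>e\<in>A. g e *\<^sub>C e) * f = (\<Sum>e\<in>A. if e = f then g f *\<^sub>C f else 0)"
      unfolding sum_distrib_right
      by (rule sum.cong) (auto simp: mult_scaleC_left atom_family_mult[OF A] that)
    then show ?thesis using that atom_familyD(1)[OF A] by simp
  qed
  have cK: "cmod (c f) \<le> K" if f: "f \<in> A" for f
  proof -
    have "norm (\<pi> f) = 1"
      using norm_projection_eq[OF star_hom_projection[OF hom]] atom_familyD[OF A] f by blast
    moreover have "\<pi> x * \<pi> f = c f *\<^sub>C \<pi> f"
      using arg_cong[OF sum_A[OF f, of c], of \<pi>] c by (simp add: star_hom_mult[OF hom] star_hom_scaleC[OF hom])
    ultimately show ?thesis
      using norm_mult_ineq[of "\<pi> x" "\<pi> f"] by (simp add: norm_scaleC K_def)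
  qed
  have "cstar x = (\<Sum>e\<in>A. cnj (c e) *\<^sub>C e)"
    unfolding c cstar_sum
    by (rule sum.cong) (auto simp: cstar_scaleC self_adjointD projection_sa atom_familyD[OF A])
  then have "cstar x * x = (\<Sum>f\<in>A. c f *\<^sub>C ((\<Sum>e\<in>A. cnj (c e) *\<^sub>C e) * f))"
    by (simp add: c sum_distrib_left mult_scaleC_right)
  also have "\<dots> = (\<Sum>f\<in>A. (cmod (c f))\<^sup>2 *\<^sub>R f)"
    by (rule sum.cong)
      (auto simp: sum_A scaleC_scaleC scaleR_scaleC complex_norm_square simp del: of_real_power)
  finally have xx: "cstar x * x = (\<Sum>f\<in>A. (cmod (c f))\<^sup>2 *\<^sub>R f)" .
  have one: "K\<^sup>2 *\<^sub>R 1 = (\<Sum>f\<in>A. K\<^sup>2 *\<^sub>R f)"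
    by (simp add: atom_familyD(5)[OF A] flip: scaleR_sum_right)
  have "norm (cstar x * x) \<le> K\<^sup>2"
  proof (rule norm_le_iff_positive)
    show "self_adjoint (cstar x * x)" by (simp add: self_adjoint_def cstar_mult cstar_cstar)
    show "positive_el (K\<^sup>2 *\<^sub>R 1 - cstar x * x)" "positive_el (K\<^sup>2 *\<^sub>R 1 + cstar x * x)"
      unfolding xx one sum_subtractf[symmetric] sum.distrib[symmetric]
        scaleR_diff_left[symmetric] scaleR_add_left[symmetric]
      by (rule positive_sum, rule positive_scaleR, rule projection_positive,
          erule atom_familyD(2)[OF A], simp add: cK power_mono)+
  qed simp
  then have "(norm x)\<^sup>2 \<le> K\<^sup>2" by (simp add: cstar_identity)
  then show "norm x \<le> norm (\<pi> x)" unfolding K_def by (rule power2_le_imp_le) simp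
qed

text \<open>Pinching by the atoms puts any element into the commutant of \<open>A\<close>.\<close>

lemma sum_atoms_conj:
  assumes A: "atom_family \<pi> A" and f: "f \<in> A"
  shows "(\<Sum>e\<in>A. e * x * e) * f = f * x * f" "f * (\<Sum>e\<in>A. e * x * e) = f * x * f"
proof -
  have "(\<Sum>e\<in>A. e * x * e) * f = (\<Sum>e\<in>A. if e = f then f * x * f else 0)"
    unfolding sum_distrib_right
    by (rule sum.cong) (auto simp: mult.assoc atom_family_mult[OF A] f)
  then show "(\<Sum>e\<in>A. e * x * e) * f = f * x * f" using f atom_familyD(1)[OF A] by simp
  have "f * (\<Sum>e\<in>A. e * x * e) = (\<Sum>e\<in>A. if e = f then f * x * f else 0)"
    unfolding sum_distrib_left
    by (rule sum.cong) (auto simp: atom_family_mult[OF A] f simp flip: mult.assoc)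
  then show "f * (\<Sum>e\<in>A. e * x * e) = f * x * f" using f atom_familyD(1)[OF A] by simp
qed

text \<open>Projections correspond to symmetries \<open>2 *\<^sub>R p - 1\<close>. Taking the real
  part of a preimage and pinching it by \<open>A\<close> leave the image unchanged, since that image
  is self-adjoint and commutes with the \<open>\<pi> e\<close>, which sum to 1. Then
  \<open>lift_symmetry\<close> applies in the commutant of \<open>A\<close>.\<close>

lemma lift_projection:
  fixes \<pi> :: "'b::cstar_algebra \<Rightarrow> 'm::cstar_algebra"
  assumes hom: "unital_star_hom \<pi>" and "surj \<pi>" and dens: "inv_dense ({}::'b set)"
    and A: "atom_family \<pi> A" and p: "projection p" "\<And>e. e \<in> A \<Longrightarrow> \<pi> e * p = p * \<pi> e"
  obtains q where "projection q" "q \<in> commutant A" "\<pi> q = p"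
proof -
  note h = star_hom_mult[OF hom] star_hom_1[OF hom] star_hom_diff[OF hom] star_hom_scaleR[OF hom]
    star_hom_add[OF hom] star_hom_sum[OF hom] star_hom_cstar[OF hom]
  define \<sigma> where "\<sigma> = 2 *\<^sub>R p - 1"
  have \<sigma>: "cstar \<sigma> = \<sigma>" "\<sigma> * \<sigma> = 1"
    using p(1) by (simp_all add: \<sigma>_def projection_def cstar_diff algebra_simps flip: scaleR_add_left)
  obtain z where z: "\<pi> z = \<sigma>" using \<open>surj \<pi>\<close> by (metis surjD)
  define x where "x = (\<Sum>e\<in>A. e * re_part z * e)"
  have x: "x \<in> commutant A"
    by (rule commutantI) (simp add: x_def sum_atoms_conj[OF A])
  have "self_adjoint (e * re_part z * e)" if "e \<in> A" for e
    using sa_sandwich[OF sa_re_part, of e z] projection_sa[OF atom_familyD(2)[OF A that]]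
    by (simp add: self_adjointD)
  then have sx: "self_adjoint x" unfolding x_def by (rule sa_sum)
  have "\<pi> (re_part z) = (1/2) *\<^sub>R (\<sigma> + \<sigma>)"
    by (simp add: re_part_def h z \<sigma>)
  then have "\<pi> (re_part z) = \<sigma>" by (simp flip: scaleR_2)
  then have "\<pi> x = (\<Sum>e\<in>A. \<pi> e * \<sigma> * \<pi> e)" by (simp add: x_def h)
  also have "\<dots> = (\<Sum>e\<in>A. \<sigma> * \<pi> e)"
  proof (rule sum.cong[OF refl])
    fix e assume e: "e \<in> A"
    have "\<pi> e * \<sigma> = \<sigma> * \<pi> e" using p(2)[OF e] by (simp add: \<sigma>_def algebra_simps)
    moreover have "\<pi> e * \<pi> e = \<pi> e" using projection_idem[OF atom_familyD(2)[OF A e]] by (metis h(1))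
    ultimately show "\<pi> e * \<sigma> * \<pi> e = \<sigma> * \<pi> e" by (simp add: mult.assoc)
  qed
  also have "\<dots> = \<sigma> * \<pi> (\<Sum>A)" by (simp add: h sum_distrib_left)
  also have "\<dots> = \<sigma>" by (simp add: atom_familyD(5)[OF A] h)
  finally have \<pi>x: "\<pi> x = \<sigma>" .
  have dA: "inv_dense A"
    using inv_dense_finite[OF dens, of A] atom_familyD[OF A] by metis
  obtain s where s: "s \<in> commutant A" "self_adjoint s" "s * s = 1" "\<pi> s = \<sigma>"
    using lift_symmetry[OF hom dA x sx] \<pi>x \<sigma> by metis
  define q where "q = (1/2) *\<^sub>R (1 + s)"
  have "projection q"
    using s by (simp add: projection_def q_def self_adjoint_def cstar_add algebra_simps)
      (simp flip: scaleR_2)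
  moreover have "q \<in> commutant A" unfolding q_def by (intro commutant_intros s)
  moreover have "\<pi> q = p" by (simp add: q_def h s(4) \<sigma>_def)
  ultimately show thesis by (rule that)
qed

lemma atom_family_refine:
  fixes \<pi> :: "'b::cstar_algebra \<Rightarrow> 'm::cstar_algebra"
  assumes hom: "unital_star_hom \<pi>" and "surj \<pi>" and dens: "inv_dense ({}::'b set)"
    and A: "atom_family \<pi> A" "\<pi> ` A \<subseteq> C" and C: "star_subalgebra C" "abelian_set C"
    and p: "projection p" "p \<in> C"
  obtains A' where "atom_family \<pi> A'" "\<pi> ` A' \<subseteq> C" "cspan A \<subseteq> cspan A'" "p \<in> \<pi> ` cspan A'"
proof -
  note h = star_hom_mult[OF hom] star_hom_1[OF hom] star_hom_diff[OF hom] star_hom_sum[OF hom]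
  have comm: "\<pi> e * p = p * \<pi> e" if "e \<in> A" for e
    using A(2) C(2) p(2) that unfolding abelian_set_def by blast
  obtain q where q: "projection q" "q \<in> commutant A" "\<pi> q = p"
    using lift_projection[OF assms(1-4) p(1) comm] .
  have qe: "q * e = e * q" if "e \<in> A" for e using q(2) that by (rule commutantD)
  \<comment> \<open>If \<open>p\<close> kills or contains \<open>\<pi> e\<close>, one of the two
    pieces of \<open>e\<close> has image 0 without having to be 0 itself; \<open>e\<close> is then
    left whole, so that \<open>\<pi>\<close> stays injective on the span.\<close>
  define R where "R e = (if \<pi> e * p = 0 \<or> \<pi> e * (1 - p) = 0 then {e} else {e * q, e * (1 - q)})" for e
  define A' where "A' = (\<Union>e\<in>A. R e)"
  note ee = projection_idem[OF atom_familyD(2)[OF A(1)]]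
  have qq: "q * q = q" using projection_idem[OF q(1)] .
  have Re: "x * e = x" "e * x = x" "projection x" "\<pi> x \<noteq> 0" "\<pi> x \<in> C" if "e \<in> A" "x \<in> R e" for x e
  proof -
    have e: "projection e" "\<pi> e \<noteq> 0" "\<pi> e \<in> C" using atom_familyD[OF A(1)] A(2) that by auto
    have q1: "projection (1 - q)" using q(1) by (rule projection_compl)
    have c: "e * q = q * e" "e * (1 - q) = (1 - q) * e" using qe[OF that(1)] by (simp_all add: algebra_simps)
    have eqC: "\<pi> e * p \<in> C" "\<pi> e - \<pi> e * p \<in> C"
    proof -
      show 1: "\<pi> e * p \<in> C" using C(1) e(3) p(2) by (simp add: star_subalgebra_def)
      have "\<pi> e + (- 1) *\<^sub>C (\<pi> e * p) \<in> C" using C(1) e(3) 1 unfolding star_subalgebra_def by blast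
      then show "\<pi> e - \<pi> e * p \<in> C" by (simp add: scaleC_one)
    qed
    note x = that(2)
    consider "x = e" | "x = e * q" "\<pi> e * p \<noteq> 0" | "x = e * (1 - q)" "\<pi> e * (1 - p) \<noteq> 0"
      using x by (auto simp: R_def split: if_splits)
    then have "x * e = x \<and> e * x = x \<and> projection x \<and> \<pi> x \<noteq> 0 \<and> \<pi> x \<in> C"
    proof cases
      case 1
      then show ?thesis using e ee[OF that(1)] by simp
    next
      case 2
      have "\<pi> x \<in> C" using 2 eqC by (simp add: h q(3))
      moreover have "x * e = x" using 2 ee[OF that(1)] c(1) by (metis mult.assoc)
      moreover have "e * x = x" using 2 ee[OF that(1)] by (metis mult.assoc)
      ultimately show ?thesis using 2 projection_mult[OF e(1) q(1) c(1)] by (simp add: h q(3))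
    next
      case 3
      have "\<pi> x \<in> C" using 3 eqC by (simp add: h q(3) right_diff_distrib)
      moreover have "x * e = x" using 3 ee[OF that(1)] c(2) by (metis mult.assoc)
      moreover have "e * x = x" using 3 ee[OF that(1)] by (metis mult.assoc)
      ultimately show ?thesis using 3 projection_mult[OF e(1) q1 c(2)] by (simp add: h q(3))
    qed
    then show "x * e = x" "e * x = x" "projection x" "\<pi> x \<noteq> 0" "\<pi> x \<in> C" by simp_all
  qed
  have orth: "x * y = 0" if "e \<in> A" "f \<in> A" "x \<in> R e" "y \<in> R f" "x \<noteq> y" for e f x y
  proof (cases "e = f")
    case True
    have "q * (e * (1 - q)) = e * (q * (1 - q))" "(1 - q) * (e * q) = (e * (1 - q)) * q"
      using qe[OF that(1)] by (simp_all add: left_diff_distrib right_diff_distrib flip: mult.assoc)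
    then have "q * (e * (1 - q)) = 0" "(1 - q) * (e * q) = 0"
      using qq by (simp_all add: left_diff_distrib right_diff_distrib mult.assoc)
    then have "e * q * (e * (1 - q)) = 0" "e * (1 - q) * (e * q) = 0"
      by (simp_all add: mult.assoc)
    then show ?thesis using that True by (auto simp: R_def split: if_splits)
  next
    case False
    have "x * y = (x * e) * (f * y)" using Re that by simp
    also have "\<dots> = x * (e * f) * y" by (simp add: mult.assoc)
    finally show ?thesis using False atom_familyD(4)[OF A(1) that(1,2)] by simp
  qed
  have finR: "finite (R e)" for e by (simp add: R_def)
  have sumR: "\<Sum>(R e) = e" if "e \<in> A" for e
  proof (cases "\<pi> e * p = 0 \<or> \<pi> e * (1 - p) = 0")
    case False
    have "e * q \<noteq> e * (1 - q)"
    proof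
      assume *: "e * q = e * (1 - q)"
      have "e * q * q = e * (1 - q) * q" by (simp add: *)
      then have "e * q = 0" using qq by (simp add: mult.assoc left_diff_distrib)
      then have "\<pi> e * p = 0" using star_hom_0[OF hom] by (metis h(1) q(3))
      with False show False by simp
    qed
    then show ?thesis using False by (simp add: R_def algebra_simps)
  qed (simp add: R_def)
  have disj: "R e \<inter> R f = {}" if "e \<in> A" "f \<in> A" "e \<noteq> f" for e f
  proof (rule ccontr)
    assume "R e \<inter> R f \<noteq> {}"
    then obtain x where x: "x \<in> R e" "x \<in> R f" by blast
    \<comment> \<open>A common element would lie below two orthogonal atoms and so be 0, although
      its image is not.\<close>
    then have "x = (x * e) * (f * x)"
      using Re that projection_idem by metis
    then have "x = x * (e * f) * x" by (simp add: mult.assoc)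
    then have "x = 0" using atom_familyD(4)[OF A(1) that] by simp
    then show False using Re(4)[OF that(1) x(1)] star_hom_0[OF hom] by simp
  qed
  have "\<Sum>A' = (\<Sum>e\<in>A. \<Sum>(R e))"
    unfolding A'_def using disj finR atom_familyD(1)[OF A(1)] by (intro sum.UNION_disjoint) auto
  also have "\<dots> = 1" using sumR atom_familyD(5)[OF A(1)] by simp
  finally have "atom_family \<pi> A'"
    using Re orth finR atom_familyD(1)[OF A(1)] by (auto simp: atom_family_def A'_def)
  moreover have "\<pi> ` A' \<subseteq> C" using Re by (auto simp: A'_def)
  moreover have sub: "A \<subseteq> cspan A'"
  proof
    fix e assume "e \<in> A"
    then have "\<Sum>(R e) \<in> cspan A'" by (intro cspan_sum cspan_base) (auto simp: A'_def)
    then show "e \<in> cspan A'" using sumR \<open>e \<in> A\<close> by simp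
  qed
  moreover have "p \<in> \<pi> ` cspan A'"
  proof -
    \<comment> \<open>Since the \<open>\<pi> e\<close> sum to 1, \<open>p\<close> is the sum of the
      \<open>\<pi> e * p\<close>, and it suffices to find a preimage of each of these.\<close>
    have "\<exists>y\<in>cspan A'. \<pi> y = \<pi> e * p" if e: "e \<in> A" for e
    proof -
      consider "\<pi> e * p = 0" | "\<pi> e * p = \<pi> e" | "e * q \<in> R e"
        by (force simp: R_def right_diff_distrib split: if_splits)
      then show ?thesis
      proof cases
        case 1
        then show ?thesis using star_hom_0[OF hom] cspan_0 by metis
      next
        case 2
        then show ?thesis using e sub by auto
      next
        case 3
        then have "e * q \<in> cspan A'" using e by (intro cspan_base) (auto simp: A'_def)
        then show ?thesis using h(1) q(3) by metis
      qed
    qed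
    then obtain y where y: "\<And>e. e \<in> A \<Longrightarrow> y e \<in> cspan A' \<and> \<pi> (y e) = \<pi> e * p" by metis
    have "\<pi> (\<Sum>e\<in>A. y e) = \<pi> (\<Sum>A) * p" using y by (simp add: h sum_distrib_right)
    then have "\<pi> (\<Sum>e\<in>A. y e) = p" by (simp add: atom_familyD(5)[OF A(1)] h)
    moreover have "(\<Sum>e\<in>A. y e) \<in> cspan A'" using y by (intro cspan_sum) auto
    ultimately show ?thesis by blast
  qed
  ultimately show thesis using that cspan_subset by blast
qed

lemma star_subalgebra_UN_incseq:
  assumes "\<And>n::nat. star_subalgebra (F n)" "incseq F"
  shows "star_subalgebra (\<Union>n. F n)"
  unfolding star_subalgebra_def
proof (intro conjI ballI allI)
  fix x y assume "x \<in> (\<Union>n. F n)" "y \<in> (\<Union>n. F n)"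
  then obtain m n where "x \<in> F m" "y \<in> F n" by blast
  then have "x \<in> F (max m n)" "y \<in> F (max m n)"
    using incseqD[OF assms(2), of m "max m n"] incseqD[OF assms(2), of n "max m n"] by auto
  then have "x + y \<in> F (max m n)" "x * y \<in> F (max m n)"
    using assms(1)[of "max m n"] by (simp_all add: star_subalgebra_def)
  then show "x + y \<in> (\<Union>n. F n)" "x * y \<in> (\<Union>n. F n)" by blast+
next
  show "0 \<in> (\<Union>n. F n)" using assms(1)[of 0] by (auto simp: star_subalgebra_def)
next
  fix c x assume "x \<in> (\<Union>n. F n)"
  then obtain n where "x \<in> F n" by blast
  then have "c *\<^sub>C x \<in> F n" "cstar x \<in> F n"
    using assms(1)[of n] by (simp_all add: star_subalgebra_def)
  then show "c *\<^sub>C x \<in> (\<Union>n. F n)" "cstar x \<in> (\<Union>n. F n)" by blast+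
qed

text \<open>Iterating \<open>atom_family_refine\<close> gives increasing spans on which
  \<open>\<pi>\<close> is isometric; \<open>E\<close> is the closure of their union. The isometry
  extends to \<open>E\<close>, so the image of \<open>E\<close> is complete, hence closed, and
  contains the closed span of \<open>P\<close>.\<close>

lemma countable_projections_lift:
  fixes \<pi> :: "'b::cstar_algebra \<Rightarrow> 'm::cstar_algebra"
  assumes hom: "unital_star_hom \<pi>" and surj: "surj \<pi>" and dens: "inv_dense ({}::'b set)"
    and C: "star_subalgebra C" "abelian_set C" "1 \<in> C"
    and P: "countable P" "P \<subseteq> {p \<in> C. projection p}"
  obtains E where "star_subalgebra E" "1 \<in> E" "inj_on \<pi> E" "closure (cspan P) \<subseteq> \<pi> ` E"
proof -
  \<comment> \<open>Adding the projection 0 makes the enumeration meaningful also for empty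
    \<open>P\<close>.\<close>
  define Pn where "Pn = from_nat_into (insert 0 P)"
  have rP: "range Pn = insert 0 P" unfolding Pn_def using P(1) by (intro range_from_nat_into) auto
  have Pn: "projection (Pn n)" "Pn n \<in> C" for n
  proof -
    have "Pn n \<in> insert 0 P" using rP by blast
    then show "projection (Pn n)" "Pn n \<in> C"
      using P(2) C(1) by (auto simp: projection_def star_subalgebra_def)
  qed
  have "\<exists>A. \<forall>n. (atom_family \<pi> (A n) \<and> \<pi> ` A n \<subseteq> C) \<and>
      (cspan (A n) \<subseteq> cspan (A (Suc n)) \<and> Pn n \<in> \<pi> ` cspan (A (Suc n)))"
  proof (rule dependent_nat_choice)
    \<comment> \<open>The start is the single atom 1, whose image 1 is not 0.\<close>
    show "\<exists>A. atom_family \<pi> A \<and> \<pi> ` A \<subseteq> C"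
      using C(3) star_hom_1[OF hom] by (intro exI[of _ "{1}"]) (auto simp: atom_family_def projection_def)
  next
    fix A n assume "atom_family \<pi> A \<and> \<pi> ` A \<subseteq> C"
    then show "\<exists>A'. (atom_family \<pi> A' \<and> \<pi> ` A' \<subseteq> C) \<and> cspan A \<subseteq> cspan A' \<and> Pn n \<in> \<pi> ` cspan A'"
      using atom_family_refine[OF hom surj dens _ _ C(1,2) Pn] by metis
  qed
  then obtain A where A: "\<And>n. atom_family \<pi> (A n)" "\<And>n. cspan (A n) \<subseteq> cspan (A (Suc n))"
    "\<And>n. Pn n \<in> \<pi> ` cspan (A (Suc n))" by metis
  have inc: "incseq (\<lambda>n. cspan (A n))" by (rule incseq_SucI) (rule A)
  define E0 where "E0 = (\<Union>n. cspan (A n))"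
  have E0: "star_subalgebra E0"
    unfolding E0_def
  proof (rule star_subalgebra_UN_incseq[OF _ inc], rule star_subalgebra_cspan)
    fix n x y
    show "self_adjoint x" if "x \<in> A n" using that atom_familyD(2)[OF A(1)] projection_sa by blast
    show "x * y \<in> cspan (A n)" if "x \<in> A n" "y \<in> A n"
      using that by (simp add: atom_family_mult[OF A(1)] cspan_base cspan_0)
  qed
  have iso0: "norm (\<pi> x) = norm x" if "x \<in> E0" for x
    using that atom_family_isometric[OF hom A(1)] by (auto simp: E0_def)
  note blin = star_hom_bounded_linear[OF hom]
  have iso: "norm (\<pi> x) = norm x" if x: "x \<in> closure E0" for x
  proof -
    obtain f where f: "\<And>n. f n \<in> E0" "f \<longlonglongrightarrow> x" using x unfolding closure_sequential by blast
    have "(\<lambda>n. norm (\<pi> (f n))) \<longlonglongrightarrow> norm (\<pi> x)"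
      by (intro tendsto_norm bounded_linear.tendsto[OF blin] f(2))
    moreover have "(\<lambda>n. norm (\<pi> (f n))) \<longlonglongrightarrow> norm x" using f iso0 by (simp add: tendsto_norm)
    ultimately show ?thesis by (rule LIMSEQ_unique)
  qed
  have E: "star_subalgebra (closure E0)" using E0 by (rule star_subalgebra_closure)
  have diffE: "x - y \<in> closure E0" if "x \<in> closure E0" "y \<in> closure E0" for x y
  proof -
    have "x + (- 1) *\<^sub>C y \<in> closure E0" using E that unfolding star_subalgebra_def by blast
    then show ?thesis by (simp add: scaleC_one)
  qed
  have inj: "inj_on \<pi> (closure E0)"
  proof (rule inj_onI)
    fix x y assume "x \<in> closure E0" "y \<in> closure E0" "\<pi> x = \<pi> y"
    then show "x = y" using iso[OF diffE, of x y] by (simp add: star_hom_diff[OF hom])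
  qed
  have "subspace (closure E0)"
    using E unfolding subspace_def star_subalgebra_def by (auto simp: scaleR_scaleC)
  then have "complete (\<pi> ` closure E0)"
    using iso by (intro complete_isometric_image[of 1] blin) (auto simp: complete_eq_closed)
  then have closed: "closed (\<pi> ` closure E0)" by (rule complete_imp_closed)
  have "P \<subseteq> \<pi> ` cspan E0"
  proof
    fix p assume "p \<in> P"
    then obtain n where "p = Pn n" using rP by blast
    then obtain x where "x \<in> cspan (A (Suc n))" "p = \<pi> x" using A(3) by blast
    then show "p \<in> \<pi> ` cspan E0" by (auto simp: E0_def intro!: imageI cspan_base)
  qed
  then have "cspan P \<subseteq> \<pi> ` cspan E0" by (rule cspan_image[OF hom])
  also have "cspan E0 \<subseteq> E0"
  proof
    fix x assume "x \<in> cspan E0"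
    then show "x \<in> E0" using E0 by induction (auto simp: star_subalgebra_def)
  qed
  also have "E0 \<subseteq> closure E0" by (rule closure_subset)
  finally have "cspan P \<subseteq> \<pi> ` closure E0" by blast
  then have "closure (cspan P) \<subseteq> \<pi> ` closure E0" using closed by (rule closure_minimal)
  moreover have "1 \<in> closure E0"
  proof -
    have "\<Sum>(A 0) \<in> cspan (A 0)" by (intro cspan_sum cspan_base)
    then have "1 \<in> E0" by (auto simp: E0_def atom_familyD(5)[OF A(1)])
    then show ?thesis using closure_subset by blast
  qed
  ultimately show thesis using that E inj by blast
qed

section \<open>Maximal abelian subalgebras\<close>

lemma masa_exists:
  assumes C: "star_subalgebra C" "abelian_set C"
  obtains D where "masa D" "C \<subseteq> D"
proof -
  define \<A> where "\<A> = {D. star_subalgebra D \<and> abelian_set D \<and> C \<subseteq> D}"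
  have "\<exists>M\<in>\<A>. \<forall>X\<in>\<A>. M \<subseteq> X \<longrightarrow> X = M"
  proof (rule subset_Zorn_nonempty)
    show "\<A> \<noteq> {}" using C by (auto simp: \<A>_def)
    fix \<C> assume ne: "\<C> \<noteq> {}" and ch: "subset.chain \<A> \<C>"
    then have mem: "star_subalgebra D" "abelian_set D" "C \<subseteq> D" if "D \<in> \<C>" for D
      using that by (auto simp: subset.chain_def \<A>_def)
    have two: "\<exists>D\<in>\<C>. x \<in> D \<and> y \<in> D" if "x \<in> \<Union>\<C>" "y \<in> \<Union>\<C>" for x y
    proof -
      from that obtain X Y where "X \<in> \<C>" "x \<in> X" "Y \<in> \<C>" "y \<in> Y" by blast
      moreover have "X \<subseteq> Y \<or> Y \<subseteq> X" using ch \<open>X \<in> \<C>\<close> \<open>Y \<in> \<C>\<close> by (auto simp: subset.chain_def)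
      ultimately show ?thesis by blast
    qed
    have "star_subalgebra (\<Union>\<C>)"
      unfolding star_subalgebra_def
    proof (intro conjI ballI allI)
      show "0 \<in> \<Union>\<C>" using ne mem(1) by (auto simp: star_subalgebra_def)
      show "x + y \<in> \<Union>\<C>" "x * y \<in> \<Union>\<C>" if "x \<in> \<Union>\<C>" "y \<in> \<Union>\<C>" for x y
        using two[OF that] mem(1) unfolding star_subalgebra_def by blast+
      show "c *\<^sub>C x \<in> \<Union>\<C>" "cstar x \<in> \<Union>\<C>" if "x \<in> \<Union>\<C>" for x c
        using that mem(1) unfolding star_subalgebra_def by blast+
    qed
    moreover have "abelian_set (\<Union>\<C>)"
      unfolding abelian_set_def using two mem(2) unfolding abelian_set_def by blast
    moreover have "C \<subseteq> \<Union>\<C>" using ne mem(3) by blast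
    ultimately show "\<Union>\<C> \<in> \<A>" by (simp add: \<A>_def)
  qed
  then obtain M where "M \<in> \<A>" "\<And>X. X \<in> \<A> \<Longrightarrow> M \<subseteq> X \<Longrightarrow> X = M" by blast
  then show thesis using that[of M] by (auto simp: \<A>_def masa_def)
qed

text \<open>The property of the target algebra on which the lifting rests; it lets one argument
  serve both AW*-algebras and von Neumann algebras.\<close>

definition masas_spanned_by_projections :: "'a::cstar_algebra itself \<Rightarrow> bool" where
  "masas_spanned_by_projections _ \<longleftrightarrow> (\<forall>C::'a set. masa C \<longrightarrow> C \<subseteq> closure (cspan {p\<in>C. projection p}))"

text \<open>Products of commuting projections are projections, so the closed span of the projections
  in \<open>C\<close> is a closed star subalgebra and contains the algebra they generate.\<close>

lemma AW_star_masas_spanned_by_projections: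
  assumes "AW_star_algebra TYPE('m::cstar_algebra)"
  shows "masas_spanned_by_projections TYPE('m)"
  unfolding masas_spanned_by_projections_def
proof (intro allI impI)
  fix C :: "'m set" assume C: "masa C"
  let ?P = "{p\<in>C. projection p}"
  have "star_subalgebra (cspan ?P)"
    using C by (intro star_subalgebra_cspan_projections) (auto simp: masa_def)
  moreover have "?P \<subseteq> closure (cspan ?P)"
    using subset_trans[OF subsetI[OF cspan_base] closure_subset] .
  ultimately have "cstar_generated ?P \<subseteq> closure (cspan ?P)"
    unfolding cstar_generated_def by (intro Inter_lower) (simp add: star_subalgebra_closure)
  moreover have "C = cstar_generated ?P" using assms C by (simp add: AW_star_algebra_def)
  ultimately show "C \<subseteq> closure (cspan ?P)" by simp
qed

lemma separable_commutative_lift: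
  fixes \<pi> :: "'b::cstar_algebra \<Rightarrow> 'm::cstar_algebra" and \<phi> :: "'a::cstar_algebra \<Rightarrow> 'm"
  assumes sep: "separable_alg TYPE('a)" and comm: "commutative_alg TYPE('a)"
    and dens: "inv_dense ({}::'b set)" and proj: "masas_spanned_by_projections TYPE('m)"
    and hom: "unital_star_hom \<pi>" and surj: "surj \<pi>" and \<phi>: "unital_star_hom \<phi>"
  shows "\<exists>\<psi>. unital_star_hom \<psi> \<and> \<pi> \<circ> \<psi> = \<phi>"
proof -
  note hphi = star_hom_add[OF \<phi>] star_hom_scaleC[OF \<phi>] star_hom_mult[OF \<phi>] star_hom_cstar[OF \<phi>] star_hom_1[OF \<phi>]
  note hpi = star_hom_add[OF hom] star_hom_scaleC[OF hom] star_hom_mult[OF hom] star_hom_cstar[OF hom] star_hom_1[OF hom]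
  have "star_subalgebra (range \<phi>)"
    unfolding star_subalgebra_def using star_hom_0[OF \<phi>]
    by (auto simp flip: hphi intro: range_eqI[OF sym])
  moreover have "abelian_set (range \<phi>)"
    using comm unfolding abelian_set_def commutative_alg_def by (auto simp flip: hphi)
  ultimately obtain C where C: "masa C" "range \<phi> \<subseteq> C" by (rule masa_exists)
  let ?P = "{p\<in>C. projection p}"
  have dense: "C \<subseteq> closure (cspan ?P)" using proj C(1) by (simp add: masas_spanned_by_projections_def)
  obtain D :: "'a set" where D: "countable D" "closure D = UNIV" using sep by (auto simp: separable_alg_def)
  \<comment> \<open>A combination approximating \<open>\<phi> d\<close> involves finitely many
    projections; ranging over a countable dense set and the accuracies 1/(n+1), countably many are
    enough.\<close>
  have "\<exists>T. finite T \<and> T \<subseteq> ?P \<and> (\<exists>u\<in>cspan T. dist u (\<phi> d) < inverse (real (Suc n)))" for d n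
  proof -
    have "\<phi> d \<in> closure (cspan ?P)" using dense C(2) by blast
    moreover have "inverse (real (Suc n)) > 0" by simp
    ultimately obtain u where u: "u \<in> cspan ?P" "dist u (\<phi> d) < inverse (real (Suc n))"
      unfolding closure_approachable by blast
    obtain T where "finite T" "T \<subseteq> ?P" "u \<in> cspan T" using cspan_finite_subset[OF u(1)] by blast
    then show ?thesis using u(2) by blast
  qed
  then obtain T where T: "\<And>d n. finite (T d n)" "\<And>d n. T d n \<subseteq> ?P"
    "\<And>d n. \<exists>u\<in>cspan (T d n). dist u (\<phi> d) < inverse (real (Suc n))"
    by metis
  define P where "P = (\<Union>d\<in>D. \<Union>n. T d n)"
  have P: "countable P" "P \<subseteq> ?P"
  proof -
    show "countable P"
      unfolding P_def by (intro countable_UN D(1) countableI_type countable_finite T(1))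
    show "P \<subseteq> ?P" unfolding P_def using T(2) by blast
  qed
  have \<phi>D: "\<phi> ` D \<subseteq> closure (cspan P)"
  proof
    fix y assume "y \<in> \<phi> ` D"
    then obtain d where d: "d \<in> D" "y = \<phi> d" by blast
    show "y \<in> closure (cspan P)"
      unfolding closure_approachable
    proof (intro allI impI)
      fix e :: real assume "e > 0"
      then obtain n where n: "inverse (real (Suc n)) < e" using reals_Archimedean by blast
      obtain u where "u \<in> cspan (T d n)" "dist u y < inverse (real (Suc n))" using T(3) d(2) by blast
      moreover have "cspan (T d n) \<subseteq> cspan P" using d(1) by (intro cspan_mono) (auto simp: P_def)
      ultimately show "\<exists>u\<in>cspan P. dist u y < e" using n by (meson less_trans subsetD)
    qed
  qed
  have "continuous_on (closure D) \<phi>"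
    using star_hom_bounded_linear[OF \<phi>] linear_continuous_on by blast
  then have \<phi>P: "\<phi> ` UNIV \<subseteq> closure (cspan P)"
    using image_closure_subset[OF _ closed_closure \<phi>D] D(2) by simp
  have "1 \<in> C" using C(2) hphi(5) by (metis rangeI subsetD)
  then obtain E where E: "star_subalgebra E" "1 \<in> E" "inj_on \<pi> E" "closure (cspan P) \<subseteq> \<pi> ` E"
    using countable_projections_lift[OF hom surj dens _ _ _ P] C(1) unfolding masa_def by metis
  define \<psi> where "\<psi> a = inv_into E \<pi> (\<phi> a)" for a
  have \<psi>: "\<psi> a \<in> E" "\<pi> (\<psi> a) = \<phi> a" for a
  proof -
    have "\<phi> a \<in> \<pi> ` E" using \<phi>P E(4) by blast
    then show "\<psi> a \<in> E" "\<pi> (\<psi> a) = \<phi> a" by (simp_all add: \<psi>_def inv_into_into f_inv_into_f)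
  qed
  \<comment> \<open>As \<open>\<pi>\<close> is injective on \<open>E\<close>, each homomorphism law
    for \<open>\<psi>\<close> follows by applying \<open>\<pi>\<close> to both sides, where it is
    the law for \<open>\<phi>\<close>.\<close>
  have uniq: "\<psi> a = x" if "x \<in> E" "\<pi> x = \<phi> a" for a x
    using inj_onD[OF E(3)] \<psi> that by metis
  have EE: "x \<in> E \<Longrightarrow> y \<in> E \<Longrightarrow> x + y \<in> E" "x \<in> E \<Longrightarrow> y \<in> E \<Longrightarrow> x * y \<in> E"
    "x \<in> E \<Longrightarrow> c *\<^sub>C x \<in> E" "x \<in> E \<Longrightarrow> cstar x \<in> E" for x y c
    using E(1) by (auto simp: star_subalgebra_def)
  have "unital_star_hom \<psi>"
    unfolding unital_star_hom_def
    by (intro conjI allI; rule uniq) (auto simp: \<psi> EE E(2) hphi hpi)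
  moreover have "\<pi> \<circ> \<psi> = \<phi>" using \<psi>(2) by auto
  ultimately show ?thesis by blast
qed

section \<open>Von Neumann algebras\<close>

lemma bounded_cfunctional_diff: "bounded_cfunctional f \<Longrightarrow> f (x - y) = f x - f y"
  unfolding bounded_cfunctional_def by (metis add_diff_cancel_right' diff_add_cancel)

lemma bounded_cfunctional_bound:
  assumes f: "bounded_cfunctional f"
  obtains K where "K \<ge> 0" "\<And>x. cmod (f x) \<le> K * norm x"
proof -
  obtain K where K: "\<And>x. cmod (f x) \<le> K * norm x" using f by (auto simp: bounded_cfunctional_def)
  have "0 \<le> K" using order_trans[OF norm_ge_zero K[of 1]] by simp
  with K show thesis by (rule that[rotated])
qed

lemma cmod_le_fnorm:
  fixes f :: "'a::cstar_algebra \<Rightarrow> complex"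
  assumes f: "bounded_cfunctional f"
  shows "cmod (f x) \<le> fnorm f * norm x"
proof (cases "x = 0")
  case True
  then show ?thesis using bounded_cfunctional_diff[OF f, of 0 0] by simp
next
  case False
  obtain K where K: "K \<ge> 0" "\<And>x. cmod (f x) \<le> K * norm x"
    using bounded_cfunctional_bound[OF f] by blast
  have "bdd_above ((\<lambda>x. cmod (f x)) ` {x. norm x \<le> 1})"
  proof (rule bdd_aboveI2)
    fix x :: 'a assume "x \<in> {x. norm x \<le> 1}"
    then show "cmod (f x) \<le> K" using K(2)[of x] mult_left_mono[of "norm x" 1 K] K(1) by simp
  qed
  then have "cmod (f ((1 / norm x) *\<^sub>R x)) \<le> fnorm f"
    unfolding fnorm_def using False by (intro cSUP_upper) auto
  moreover have "f ((1 / norm x) *\<^sub>R x) = complex_of_real (1 / norm x) * f x"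
    using f unfolding scaleR_scaleC bounded_cfunctional_def by blast
  ultimately show ?thesis using False by (simp add: norm_mult norm_divide field_simps)
qed

text \<open>If \<open>X\<close> is bounded and converges against every functional of the predual, the limit functional is
  bounded, hence given by an element \<open>g\<close>; norm balls are closed under such limits.\<close>
lemma W_star_limit:
  fixes X :: "nat \<Rightarrow> 'm::cstar_algebra"
  assumes W: "W_star_algebra TYPE('m)"
    and bound: "\<And>n. norm (X n) \<le> K"
    and conv: "\<And>f. bounded_cfunctional f \<Longrightarrow> convergent (\<lambda>n. f (X n))"
  shows "\<exists>g. \<forall>y r. (\<forall>\<^sub>F n in sequentially. norm (X n + y) \<le> r) \<longrightarrow> norm (g + y) \<le> r"
proof -
  from W obtain S :: "('m \<Rightarrow> complex) set" where S': "\<forall>f\<in>S. bounded_cfunctional f" "(\<lambda>_. 0) \<in> S"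
    and norm_S': "\<forall>a. norm a = Sup ((\<lambda>f. cmod (f a)) ` {f\<in>S. fnorm f \<le> 1})"
    and dual: "\<forall>\<phi>. (\<forall>f\<in>S. \<forall>g\<in>S. \<phi> (\<lambda>x. f x + g x) = \<phi> f + \<phi> g) \<and>
           (\<forall>c. \<forall>f\<in>S. \<phi> (\<lambda>x. c * f x) = c * \<phi> f) \<and>
           (\<exists>K. \<forall>f\<in>S. cmod (\<phi> f) \<le> K * fnorm f) \<longrightarrow> (\<exists>a. \<forall>f\<in>S. \<phi> f = f a)"
    unfolding W_star_algebra_def by (elim exE conjE) (rule that, assumption+)
  have S: "\<And>f. f \<in> S \<Longrightarrow> bounded_cfunctional f" "(\<lambda>_. 0) \<in> S" using S' by blast+
  note norm_S = norm_S'[rule_format]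
  define \<Phi> where "\<Phi> f = lim (\<lambda>n. f (X n))" for f :: "'m \<Rightarrow> complex"
  have \<Phi>: "(\<lambda>n. f (X n)) \<longlonglongrightarrow> \<Phi> f" if "f \<in> S" for f
    unfolding \<Phi>_def using conv[OF S(1)[OF that]] by (simp add: convergent_LIMSEQ_iff)
  have "\<exists>g. \<forall>f\<in>S. \<Phi> f = f g"
  proof (rule dual[rule_format], intro conjI ballI allI exI)
    fix f g assume "f \<in> S" "g \<in> S"
    from tendsto_add[OF \<Phi>[OF this(1)] \<Phi>[OF this(2)]]
    show "\<Phi> (\<lambda>x. f x + g x) = \<Phi> f + \<Phi> g" unfolding \<Phi>_def[of "\<lambda>x. f x + g x"] by (rule limI)
  next
    fix c f assume "f \<in> S"
    from tendsto_mult_left[OF \<Phi>[OF this], of c]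
    show "\<Phi> (\<lambda>x. c * f x) = c * \<Phi> f" unfolding \<Phi>_def[of "\<lambda>x. c * f x"] by (rule limI)
  next
    fix f assume f: "f \<in> S"
    have "0 \<le> fnorm f" using order_trans[OF norm_ge_zero cmod_le_fnorm[OF S(1)[OF f], of 1]] by simp
    then have "cmod (f (X n)) \<le> K * fnorm f" for n
      using cmod_le_fnorm[OF S(1)[OF f], of "X n"] mult_right_mono[OF bound[of n], of "fnorm f"]
      by (simp add: mult.commute)
    then show "cmod (\<Phi> f) \<le> K * fnorm f"
      by (intro LIMSEQ_le_const2[OF tendsto_norm[OF \<Phi>[OF f]]]) auto
  qed
  then obtain g where g: "\<And>f. f \<in> S \<Longrightarrow> \<Phi> f = f g" by blast
  have "norm (g + y) \<le> r" if ev: "\<forall>\<^sub>F n in sequentially. norm (X n + y) \<le> r" for y r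
    unfolding norm_S
  proof (rule cSup_least)
    \<comment> \<open>The zero functional shows that the supremum in the norm formula is over a
      nonempty set.\<close>
    have "fnorm (\<lambda>_::'m. 0) = 0" unfolding fnorm_def
      by (subst cSUP_const) (auto intro: exI[of _ 0])
    then show "(\<lambda>f. cmod (f (g + y))) ` {f \<in> S. fnorm f \<le> 1} \<noteq> {}" using S(2) by auto
  next
    fix c assume "c \<in> (\<lambda>f. cmod (f (g + y))) ` {f \<in> S. fnorm f \<le> 1}"
    then obtain f where f: "f \<in> S" "fnorm f \<le> 1" "c = cmod (f (g + y))" by blast
    have add: "f (a + b) = f a + f b" for a b
      using S(1)[OF f(1)] by (simp add: bounded_cfunctional_def)
    have "(\<lambda>n. cmod (f (X n + y))) \<longlonglongrightarrow> c"
      unfolding f(3) add using \<Phi>[OF f(1)] g[OF f(1)] by (intro tendsto_intros) simp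
    moreover have "\<forall>\<^sub>F n in sequentially. cmod (f (X n + y)) \<le> r"
      using ev
    proof eventually_elim
      case (elim n)
      have "cmod (f (X n + y)) \<le> fnorm f * norm (X n + y)" by (rule cmod_le_fnorm[OF S(1)[OF f(1)]])
      also have "\<dots> \<le> 1 * norm (X n + y)" using f(2) by (intro mult_right_mono) auto
      finally show ?case using elim by simp
    qed
    ultimately show "c \<le> r" by (intro tendsto_upperbound) auto
  qed
  then show ?thesis by blast
qed

section \<open>Powers of an element between 0 and 1, and their infimum\<close>

lemma positive_power: "positive_el h \<Longrightarrow> positive_el ((h::'a::cstar_algebra) ^ n)"
  by (induction n) (auto intro: positive_mult simp: power_commutes)

lemma positive_power_diff:
  assumes h: "positive_el h" "positive_el (1 - (h::'a::cstar_algebra))" and "m \<le> n"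
  shows "positive_el (h ^ m - h ^ n)"
proof -
  have Suc: "positive_el (h ^ k - h ^ Suc k)" for k
    using positive_mult[OF positive_power[OF h(1)] h(2), of k]
    by (simp add: algebra_simps power_commutes)
  show ?thesis
    using \<open>m \<le> n\<close>
  proof (induction n rule: dec_induct)
    case (step n)
    then show ?case using positive_add[OF step.IH Suc[of n]] by simp
  qed simp
qed

lemma norm_positive_le_1:
  assumes "positive_el a" "positive_el (1 - (a::'a::cstar_algebra))" shows "norm a \<le> 1"
  using norm_le_iff_positive[of a 1] assms positive_add[of 1 a] positive_el_sa by auto

text \<open>Signed partial sums of the positive elements \<open>h\<^sup>n - h\<^sup>n\<^sup>+\<^sup>1\<close> lie in the unit ball, which
  makes the series \<open>f (h\<^sup>n - h\<^sup>n\<^sup>+\<^sup>1)\<close> absolutely convergent.\<close>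
lemma functional_powers_convergent:
  fixes h :: "'a::cstar_algebra"
  assumes h: "positive_el h" "positive_el (1 - h)" and f: "bounded_cfunctional f"
  shows "convergent (\<lambda>n. f (h ^ n))"
proof -
  define d where "d n = h ^ n - h ^ Suc n" for n
  have d: "positive_el (d n)" for n unfolding d_def by (rule positive_power_diff[OF h]) simp
  have tele: "(\<Sum>k<n. d k) = 1 - h ^ n" for n
    unfolding d_def by (induction n) auto
  have signed: "norm (\<Sum>k<n. c k *\<^sub>R d k) \<le> 1" if c: "\<And>k. \<bar>c k\<bar> \<le> 1" for c n
  proof (rule norm_le_iff_positive)
    show "self_adjoint (\<Sum>k<n. c k *\<^sub>R d k)" by (intro sa_sum sa_scaleR positive_el_sa d)
    \<comment> \<open>The \<open>d k\<close> telescope to \<open>1 - h ^ n\<close>, so these two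
      elements are 1 minus and 1 plus the signed sum.\<close>
    have "positive_el (h ^ n + (\<Sum>k<n. (1 - c k) *\<^sub>R d k))" "positive_el (h ^ n + (\<Sum>k<n. (1 + c k) *\<^sub>R d k))"
      using c by (auto intro!: positive_add positive_sum positive_scaleR d positive_power h simp: abs_le_iff)
        (smt (verit) c)+
    moreover have "h ^ n + (\<Sum>k<n. (1 - c k) *\<^sub>R d k) = 1 *\<^sub>R 1 - (\<Sum>k<n. c k *\<^sub>R d k)"
      "h ^ n + (\<Sum>k<n. (1 + c k) *\<^sub>R d k) = 1 *\<^sub>R 1 + (\<Sum>k<n. c k *\<^sub>R d k)"
      by (simp_all add: scaleR_diff_left scaleR_add_left sum_subtractf sum.distrib tele)
    ultimately show "positive_el (1 *\<^sub>R 1 - (\<Sum>k<n. c k *\<^sub>R d k))"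
      "positive_el (1 *\<^sub>R 1 + (\<Sum>k<n. c k *\<^sub>R d k))" by simp_all
  qed simp
  obtain K where K: "K \<ge> 0" "\<And>x. cmod (f x) \<le> K * norm x"
    using bounded_cfunctional_bound[OF f] by blast
  have summ: "summable (\<lambda>k. L (d k))"
    if L: "linear L" "\<And>x. \<bar>L x\<bar> \<le> K * norm x" for L :: "'a \<Rightarrow> real"
  proof (rule summable_rabs_cancel, rule summableI_nonneg_bounded)
    fix n
    \<comment> \<open>The signs of the reals \<open>L (d k)\<close> serve as the coefficients of the
      signed sum.\<close>
    have "(\<Sum>k<n. \<bar>L (d k)\<bar>) = L (\<Sum>k<n. sgn (L (d k)) *\<^sub>R d k)"
      by (simp add: linear_sum[OF L(1)] linear_scale[OF L(1)] abs_sgn mult.commute)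
    also have "\<dots> \<le> K * norm (\<Sum>k<n. sgn (L (d k)) *\<^sub>R d k)"
      using L(2) abs_le_D1 by blast
    also have "\<dots> \<le> K * 1"
      using K(1) by (intro mult_left_mono signed) (auto simp: sgn_real_def)
    finally show "(\<Sum>k<n. \<bar>L (d k)\<bar>) \<le> K" by simp
  qed simp
  have add: "f (x + y) = f x + f y" and sc: "f (r *\<^sub>R x) = complex_of_real r * f x" for x y r
    using f by (simp_all add: bounded_cfunctional_def scaleR_scaleC)
  have "summable (\<lambda>k. f (d k))"
    unfolding summable_complex_iff
  proof
    show "summable (\<lambda>k. Re (f (d k)))" "summable (\<lambda>k. Im (f (d k)))"
      by (rule summ; (rule linearI)?;
          (simp add: add sc order_trans[OF abs_Re_le_cmod K(2)] order_trans[OF abs_Im_le_cmod K(2)])?)+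
  qed
  then have "convergent (\<lambda>n. f 1 - (\<Sum>k<n. f (d k)))"
    by (intro convergent_diff convergent_const) (simp add: summable_iff_convergent)
  moreover have "f 1 - (\<Sum>k<n. f (d k)) = f (h ^ n)" for n
    using sum_lessThan_telescope'[of "\<lambda>n. f (h ^ n)" n]
    by (simp add: d_def bounded_cfunctional_diff[OF f] del: power_Suc)
  ultimately show ?thesis by simp
qed

lemma positive_unitary_conj:
  assumes a: "positive_el a" and u: "u * cstar u = (1::'a::cstar_algebra)"
  shows "positive_el (cstar u * a * u)"
proof -
  obtain b where b: "positive_el b" "b * b = a" using positive_sqrt[OF a] by blast
  have "cstar u * a * u = (cstar u * b * u) * (cstar u * b * u)"
    using u b(2) by (metis mult.assoc mult_1_right)
  then show ?thesis
    using positive_square[OF sa_sandwich[OF positive_el_sa[OF b(1)]]] by simp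
qed

text \<open>The limit \<open>g\<close> from \<open>W_star_limit\<close> inherits only norm
  inequalities, so self-adjointness and both order relations are first expressed by norms.\<close>

lemma W_star_inf_powers:
  fixes h :: "'m::cstar_algebra"
  assumes W: "W_star_algebra TYPE('m)" and h: "positive_el h" "positive_el (1 - h)"
  obtains g where "self_adjoint g" "\<And>n. positive_el (h ^ n - g)"
    "\<And>k. (\<And>n. positive_el (h ^ n - k)) \<Longrightarrow> positive_el (g - k)"
proof -
  have hn: "positive_el (h ^ n)" "norm (h ^ n) \<le> 1" for n
    using positive_power[OF h(1)] positive_power_diff[OF h, of 0 n] norm_positive_le_1[of "h ^ n"] by simp_all
  obtain g where g: "\<And>y r. (\<forall>\<^sub>F n in sequentially. norm (h ^ n + y) \<le> r) \<Longrightarrow> norm (g + y) \<le> r"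
    using W_star_limit[where X = "\<lambda>n. h ^ n", OF W hn(2) functional_powers_convergent[OF h]] by blast
  define b where "b = im_part g"
  \<comment> \<open>The powers are self-adjoint contractions, so adding an imaginary scalar i t
    gives norm at most sqrt (1 + t^2). This passes to \<open>g\<close>, and the imaginary part of g
    + i t is b + t.\<close>
  have b_shift: "norm (b + t *\<^sub>R 1) \<le> sqrt (1 + t\<^sup>2)" for t
  proof -
    define i where "i = (\<i> *\<^sub>C (t *\<^sub>R 1) :: 'm)"
    have ci: "cstar i = - i" by (simp add: i_def cstar_scaleC)
    have "i * i = \<i> *\<^sub>C \<i> *\<^sub>C ((t *\<^sub>R 1) * (t *\<^sub>R 1))"
      by (simp only: i_def mult_scaleC_left mult_scaleC_right)
    then have i2: "i * i = - (t\<^sup>2 *\<^sub>R 1)" by (simp add: i_scaleC_i power2_eq_square)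
    have ix: "x * i = i * x" for x
      by (simp add: i_def mult_scaleC_left mult_scaleC_right)
    have "norm (h ^ n + i) \<le> sqrt (1 + t\<^sup>2)" for n
    proof (rule real_le_rsqrt)
      have "cstar (h ^ n + i) * (h ^ n + i) = h ^ n * h ^ n + t\<^sup>2 *\<^sub>R 1"
        using self_adjointD[OF positive_el_sa[OF hn(1)], of n]
        by (simp add: cstar_add ci distrib_left left_diff_distrib ix[of "h ^ n"] i2)
      then have "(norm (h ^ n + i))\<^sup>2 = norm (h ^ (n + n) + t\<^sup>2 *\<^sub>R 1)"
        using cstar_identity[of "h ^ n + i"] by (simp add: power_add)
      also have "\<dots> \<le> 1 + t\<^sup>2"
        using norm_triangle_ineq[of "h ^ (n + n)" "t\<^sup>2 *\<^sub>R 1"] hn(2)[of "n + n"] by simp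
      finally show "(norm (h ^ n + i))\<^sup>2 \<le> 1 + t\<^sup>2" .
    qed
    then have "norm (g + i) \<le> sqrt (1 + t\<^sup>2)" by (intro g) simp
    moreover have "im_part (g + i) = b + t *\<^sub>R 1"
    proof -
      have "cstar (g + i) - (g + i) = (cstar g - g) - 2 *\<^sub>R i"
        by (simp add: cstar_add ci scaleR_2)
      then have "im_part (g + i) = b - \<i> *\<^sub>C i"
        by (simp only: im_part_def b_def scaleC_diff_right scaleC_scaleR_commute scaleR_diff_right
            scaleR_scaleR) simp
      then show ?thesis by (simp add: i_def i_scaleC_i)
    qed
    ultimately show ?thesis using norm_im_part[of "g + i"] by simp
  qed
  have sb: "self_adjoint b" unfolding b_def by (rule sa_im_part)
  have eps: "positive_el (b + e *\<^sub>R 1)" "positive_el (- b + e *\<^sub>R 1)" if e: "e > 0" for e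
  proof -
    \<comment> \<open>Taking \<open>t = 1/e\<close> gives b \<le> sqrt (1 + 1/e^2) - 1/e \<le> e,
      and \<open>t = - (1/e)\<close> gives b \<ge> -e.\<close>
    have "1 + (1/e)\<^sup>2 \<le> (1/e + e)\<^sup>2" using e by (simp add: power2_sum)
    then have le: "sqrt (1 + (1/e)\<^sup>2) \<le> 1/e + e" using e by (intro real_le_lsqrt) auto
    have "norm (b + (1/e) *\<^sub>R 1) \<le> 1/e + e" "norm (b + (- (1/e)) *\<^sub>R 1) \<le> 1/e + e"
      using order_trans[OF b_shift[of "1/e"] le] order_trans[OF b_shift[of "- (1/e)"]] le by simp_all
    then have "positive_el ((1/e + e) *\<^sub>R 1 - (b + (1/e) *\<^sub>R 1))"
      "positive_el ((1/e + e) *\<^sub>R 1 + (b + (- (1/e)) *\<^sub>R 1))"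
      by (intro positive_bound sa_intros sb; simp)+
    moreover have "(1/e + e) *\<^sub>R 1 - (b + (1/e) *\<^sub>R 1) = - b + e *\<^sub>R 1"
      "(1/e + e) *\<^sub>R 1 + (b + (- (1/e)) *\<^sub>R 1) = b + e *\<^sub>R 1"
      by (simp_all add: scaleR_add_left)
    ultimately show "positive_el (b + e *\<^sub>R 1)" "positive_el (- b + e *\<^sub>R 1)" by (simp_all only:)
  qed
  have "positive_el b" "positive_el (- b)"
    by (rule positive_archimedean, erule eps)+
  then have "b = 0" by (rule positive_antisym)
  then have sg: "self_adjoint g"
    using re_im_part[of g] sa_re_part[of g] by (simp add: b_def)
  have lower: "positive_el (h ^ m - g)" for m
  proof (rule positive_elI)
    show "self_adjoint (h ^ m - g)" by (intro sa_intros positive_el_sa[OF h(1)] sg)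
    \<comment> \<open>For \<open>n \<ge> m\<close> the element \<open>h ^ m - h ^ n\<close> is
      positive of norm at most 2, hence within 2 of the scalar 2; that this holds eventually in
      \<open>n\<close> is enough for the limit.\<close>
    have "norm (h ^ n + (2 *\<^sub>R 1 - h ^ m)) \<le> 2" if "m \<le> n" for n
    proof -
      have "norm (h ^ m - h ^ n) \<le> 2"
        using norm_triangle_ineq4[of "h ^ m" "h ^ n"] hn(2)[of m] hn(2)[of n] by simp
      from positive_norm[OF positive_power_diff[OF h that] this]
      show ?thesis by (simp add: algebra_simps)
    qed
    then have "norm (g + (2 *\<^sub>R 1 - h ^ m)) \<le> 2"
      by (intro g eventually_sequentiallyI[of m])
    then show "norm (2 *\<^sub>R 1 - (h ^ m - g)) \<le> 2" by (simp add: algebra_simps)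
  qed
  have greatest: "positive_el (g - k)" if k: "\<And>n. positive_el (h ^ n - k)" for k
  proof (rule positive_elI)
    have sk: "self_adjoint k"
      using sa_diff[OF sa_1 positive_el_sa[OF k[of 0]]] by simp
    then show "self_adjoint (g - k)" by (intro sa_intros sg)
    define t where "t = 1 + norm k"
    have "norm (h ^ n + (- k - t *\<^sub>R 1)) \<le> t" for n
    proof -
      have "norm (h ^ n - k) \<le> t"
        using norm_triangle_ineq4[of "h ^ n" k] hn(2)[of n] by (simp add: t_def)
      from positive_norm[OF k this] show ?thesis
        by (metis (no_types, opaque_lifting) norm_minus_commute diff_conv_add_uminus add.assoc)
    qed
    then have "norm (g + (- k - t *\<^sub>R 1)) \<le> t" by (intro g) simp
    then show "norm (t *\<^sub>R 1 - (g - k)) \<le> t"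
      by (metis (no_types, opaque_lifting) norm_minus_commute diff_conv_add_uminus add.assoc)
  qed
  show thesis using that sg lower greatest .
qed

lemma commute_re_im_part:
  assumes "self_adjoint h" "z * h = h * z"
  shows "re_part z * h = h * re_part z" "im_part z * h = h * im_part z"
proof -
  have "cstar z * h = h * cstar z"
    using arg_cong[OF assms(2), of cstar] assms(1) by (simp add: cstar_mult self_adjoint_def)
  then show "re_part z * h = h * re_part z" "im_part z * h = h * im_part z"
    using assms(2) by (simp_all add: re_part_def im_part_def distrib_left distrib_right
        left_diff_distrib right_diff_distrib mult_scaleC_left mult_scaleC_right)
qed

text \<open>A self-adjoint contraction \<open>c\<close> is the real part of the unitary c + i sqrt
  (1 - c^2), which commutes with \<open>h\<close> if \<open>c\<close> does. A general
  \<open>z\<close> is split into real and imaginary parts.\<close>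

lemma commute_if_unitaries_commute:
  fixes g h z :: "'a::cstar_algebra"
  assumes un: "\<And>u. cstar u * u = 1 \<Longrightarrow> u * cstar u = 1 \<Longrightarrow> u * h = h * u \<Longrightarrow> u * g = g * u"
    and h: "self_adjoint h" and g: "self_adjoint g" and z: "z * h = h * z"
  shows "z * g = g * z"
proof -
  have sa: "a * g = g * a" if a: "self_adjoint a" "a * h = h * a" for a
  proof -
    define c where "c = (1 / (norm a + 1)) *\<^sub>R a"
    have n: "norm a + 1 > 0" by (simp add: add_nonneg_pos)
    have c: "self_adjoint c" "c * h = h * c" "norm c \<le> 1"
      using a n by (auto simp: c_def sa_scaleR)
    have cc: "norm (c * c) \<le> 1" using c by (simp add: norm_sa_square power_le_one)
    obtain b where b: "b * b = 1 - c * c" "self_adjoint b" "\<And>z. z * (c * c) = (c * c) * z \<Longrightarrow> z * b = b * z"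
      using sqrt_one_minus[OF cc] sa_square[OF c(1)] by metis
    have cb: "c * b = b * c" by (rule b(3)) (simp add: mult.assoc)
    have hb: "h * b = b * h" by (rule b(3)) (metis c(2) mult.assoc)
    define u where "u = c + \<i> *\<^sub>C b"
    have cu: "cstar u = c - \<i> *\<^sub>C b"
      using b(2) c(1) by (simp add: u_def cstar_add cstar_scaleC self_adjoint_def)
    have "cstar u * u = c * c + b * b" "u * cstar u = c * c + b * b"
      unfolding cu unfolding u_def
      by (simp_all add: algebra_simps mult_scaleC_left mult_scaleC_right scaleC_diff_right
          scaleC_add_right i_scaleC_i cb)
    then have uu: "cstar u * u = 1" "u * cstar u = 1" using b(1) by simp_all
    have "u * h = h * u"
      using c(2) hb by (simp add: u_def distrib_left distrib_right mult_scaleC_left mult_scaleC_right)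
    then have ug: "u * g = g * u" using un uu by blast
    have "re_part u = (1/2) *\<^sub>R (c + c)" unfolding re_part_def cu by (simp add: u_def)
    then have "re_part u = c" by (simp flip: scaleR_2)
    then have "c * g = g * c" using commute_re_im_part(1)[OF g ug] by simp
    then show ?thesis using n by (simp add: c_def)
  qed
  have "re_part z * g = g * re_part z" "im_part z * g = g * im_part z"
    using commute_re_im_part[OF h z] by (auto intro: sa sa_intros)
  then have "(re_part z + \<i> *\<^sub>C im_part z) * g = g * (re_part z + \<i> *\<^sub>C im_part z)"
    by (simp add: distrib_left distrib_right mult_scaleC_left mult_scaleC_right)
  then show ?thesis by (simp add: re_im_part)
qed

text \<open>Conjugation by a unitary \<open>u\<close> commuting with \<open>h\<close> fixes the
  powers of \<open>h\<close>, so \<open>cstar u * g * u\<close> is again a lower bound of them and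
  lies below \<open>g\<close>; the same for \<open>cstar u\<close> gives equality.\<close>

lemma inf_powers_commute:
  fixes g h z :: "'a::cstar_algebra"
  assumes h: "self_adjoint h" and sg: "self_adjoint g"
    and lower: "\<And>n. positive_el (h ^ n - g)"
    and greatest: "\<And>k. (\<And>n. positive_el (h ^ n - k)) \<Longrightarrow> positive_el (g - k)"
    and z: "z * h = h * z"
  shows "z * g = g * z"
proof (rule commute_if_unitaries_commute[OF _ h sg z])
  have conj: "positive_el (g - cstar u * g * u)"
    if u: "cstar u * u = 1" "u * cstar u = 1" "u * h = h * u" for u
  proof (rule greatest)
    fix n
    have "u * h ^ n = h ^ n * u" using u(3) by (metis power_commuting_commutes)
    then have "cstar u * h ^ n * u = h ^ n" using u(1) by (metis mult.assoc mult_1_left)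
    then have "cstar u * (h ^ n - g) * u = h ^ n - cstar u * g * u"
      by (simp add: right_diff_distrib left_diff_distrib)
    then show "positive_el (h ^ n - cstar u * g * u)"
      using positive_unitary_conj[OF lower u(2), of n] by simp
  qed
  fix u assume u: "cstar u * u = 1" "u * cstar u = 1" "u * h = h * u"
  have "cstar u * h = h * cstar u"
    using arg_cong[OF u(3), of cstar] h by (simp add: cstar_mult self_adjoint_def)
  then have "positive_el (g - u * g * cstar u)" using conj[of "cstar u"] u by (simp add: cstar_cstar)
  from positive_unitary_conj[OF this u(2)]
  have "positive_el (cstar u * g * u - (cstar u * u) * g * (cstar u * u))"
    by (simp add: right_diff_distrib left_diff_distrib mult.assoc)
  then have "positive_el (cstar u * g * u - g)" using u by simp
  then have "g = cstar u * g * u" using conj[OF u] by (intro positive_le_antisym)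
  then have "u * g = (u * cstar u) * g * u" by (metis mult.assoc)
  then show "u * g = g * u" using u by simp
qed

text \<open>Here \<open>h\<close> is 1 - 2 y_+ / K and \<open>k\<close> is 2 y_- / K for the
  positive and negative parts of \<open>y\<close>. The infimum \<open>g\<close> of the powers of
  \<open>h\<close> is a projection that annihilates y_+ and fixes y_-, so
  \<open>s = 1 - 2 *\<^sub>R g\<close> reverses the sign of y_- only.\<close>

lemma W_star_symmetry:
  fixes y :: "'m::cstar_algebra"
  assumes W: "W_star_algebra TYPE('m)" and y: "self_adjoint y"
  obtains s where "self_adjoint s" "s * s = 1" "positive_el (y * s)" "\<And>z. z * y = y * z \<Longrightarrow> z * s = s * z"
proof -
  obtain b where b: "positive_el b" "b * b = y * y" "positive_el (b - y)" "positive_el (b + y)"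
    "\<And>z. z * y = y * z \<Longrightarrow> z * b = b * z"
    using abs_el_exists[OF y] by blast
  have yb: "y * b = b * y" by (rule b(5)) simp
  define K where "K = norm b + norm y + 1"
  have K: "K > 0" by (simp add: K_def add_nonneg_pos)
  define h k where "h = 1 - (1 / K) *\<^sub>R (b + y)" and "k = (1 / K) *\<^sub>R (b - y)"
  have nb: "norm ((1 / K) *\<^sub>R (b + y)) \<le> 1" "norm k \<le> 1"
    using K norm_triangle_ineq[of b y] norm_triangle_ineq4[of b y] by (auto simp: k_def K_def)
  have k: "positive_el k" "positive_el (1 - k)"
  proof -
    show "positive_el k" unfolding k_def using b(3) K by (intro positive_scaleR) auto
    from positive_bound(1)[OF positive_el_sa[OF this] nb(2)] show "positive_el (1 - k)" by simp
  qed
  have h: "positive_el h" "positive_el (1 - h)"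
  proof -
    have p: "positive_el ((1 / K) *\<^sub>R (b + y))" using b(4) K by (intro positive_scaleR) auto
    then show "positive_el (1 - h)" by (simp add: h_def)
    from positive_bound(1)[OF positive_el_sa[OF p] nb(1)] show "positive_el h" by (simp add: h_def)
  qed
  obtain g where g: "self_adjoint g" "\<And>n. positive_el (h ^ n - g)"
    "\<And>k. (\<And>n. positive_el (h ^ n - k)) \<Longrightarrow> positive_el (g - k)"
    using W_star_inf_powers[OF W h] by blast
  have comm: "z * g = g * z" if "z * h = h * z" for z
    using inf_powers_commute[OF positive_el_sa[OF h(1)] g that] .
  have g0: "positive_el g" using g(3)[of 0] positive_power[OF h(1)] by simp
  have g1: "positive_el (1 - g)" using g(2)[of 0] by simp
  have hg: "h * g = g * h" by (rule comm) simp
  have gg: "g * g = g"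
  proof -
    \<comment> \<open>As \<open>r * r = g\<close> lies below \<open>h ^ n * h ^ n\<close>, the root
      \<open>r\<close> is a lower bound of the powers too, so \<open>r \<le> g\<close>; and 0 \<le>
      r \<le> 1 gives \<open>g = r * r \<le> r\<close>.\<close>
    obtain r where r: "positive_el r" "r * r = g" "\<And>z. z * g = g * z \<Longrightarrow> z * r = r * z"
      using positive_sqrt[OF g0] by blast
    have hr: "h * r = r * h" using hg by (rule r(3))
    have low: "positive_el (h ^ n - r)" for n
    proof (rule positive_diff_of_square[OF positive_el_sa[OF r(1)] positive_power[OF h(1)]])
      show "r * h ^ n = h ^ n * r" using hr by (metis power_commuting_commutes)
      show "positive_el (h ^ n * h ^ n - r * r)" using g(2)[of "n + n"] by (simp add: r(2) power_add)
    qed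
    then have "positive_el (g - r)" by (rule g(3))
    moreover have "positive_el (r * (1 - r))"
      using low[of 0] by (intro positive_mult r) (simp_all add: algebra_simps)
    then have "positive_el (r - g)" by (simp add: right_diff_distrib r(2))
    ultimately have "r = g" by (intro positive_le_antisym)
    then show ?thesis using r(2) by simp
  qed
  \<comment> \<open>Multiplying g \<le> h \<le> 1 by the projection \<open>g\<close> squeezes
    \<open>h * g\<close>.\<close>
  have hg1: "h * g = g"
  proof (rule positive_le_antisym)
    have "positive_el ((h - g) * g)"
      using g(2)[of 1] g0 hg by (intro positive_mult) (simp_all add: algebra_simps)
    then show "positive_el (h * g - g)" by (simp add: left_diff_distrib gg)
    have "positive_el ((1 - h) * g)" using h(2) g0 hg by (intro positive_mult) (simp_all add: algebra_simps)
    then show "positive_el (g - h * g)" by (simp add: left_diff_distrib)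
  qed
  have prod0: "(b + y) * (b - y) = 0" using b(2) yb by (simp add: algebra_simps)
  then have hk: "h * k = k" by (simp add: h_def k_def left_diff_distrib)
  have kh: "k * h = h * k" using yb by (simp add: h_def k_def algebra_simps)
  have kg: "k * g = g * k" using kh by (rule comm)
  have "k = g * k"
  proof -
    \<comment> \<open>By \<open>h * k = k\<close>, \<open>h ^ n - k\<close> is the product of
      \<open>h ^ n\<close> and \<open>1 - k\<close>, so \<open>k \<le> g\<close>. Then
      \<open>(1 - g) * k\<close> and its negative \<open>(1 - g) * (g - k)\<close> are both
      positive.\<close>
    have hnk: "h ^ n * k = k" for n by (induction n) (simp_all add: hk mult.assoc)
    have hnk': "h ^ n * k = k * h ^ n" for n using kh by (metis power_commuting_commutes)
    have "positive_el (h ^ n - k)" for n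
      using positive_mult[OF positive_power[OF h(1)] k(2), of n] hnk[of n] hnk'[of n]
      by (simp add: right_diff_distrib left_diff_distrib)
    then have gk: "positive_el (g - k)" by (rule g(3))
    have "positive_el ((1 - g) * (g - k))"
      by (rule positive_mult[OF g1 gk]) (simp add: algebra_simps kg)
    moreover have "(1 - g) * (g - k) = - ((1 - g) * k)" by (simp add: algebra_simps gg)
    moreover have "positive_el ((1 - g) * k)"
      by (rule positive_mult[OF g1 k(1)]) (simp add: algebra_simps kg)
    ultimately have "(1 - g) * k = 0" using positive_antisym by metis
    then show ?thesis by (simp add: left_diff_distrib)
  qed
  then have bmy: "(b - y) * g = b - y"
    using K kg by (simp add: k_def)
  have bpy: "(b + y) * g = 0" using K hg1 by (simp add: h_def left_diff_distrib)
  define s where "s = 1 - 2 *\<^sub>R g"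
  have "self_adjoint s" unfolding s_def by (intro sa_intros g)
  moreover have "s * s = 1" by (simp add: s_def algebra_simps gg flip: scaleR_add_left)
  moreover have "y * s = b"
  proof -
    have "2 *\<^sub>R (y * g) = (b + y) * g - (b - y) * g" by (simp add: algebra_simps scaleR_2)
    also have "\<dots> = y - b" by (simp add: bmy bpy)
    finally show ?thesis by (simp add: s_def right_diff_distrib)
  qed
  moreover have "\<And>z. z * y = y * z \<Longrightarrow> z * s = s * z"
  proof -
    fix z assume that: "z * y = y * z"
    have "z * h = h * z" using that b(5)[OF that] by (simp add: h_def algebra_simps)
    then show "z * s = s * z" using comm[of z] by (simp add: s_def right_diff_distrib left_diff_distrib)
  qed
  moreover from \<open>y * s = b\<close> have "positive_el (y * s)" using b(1) by simp
  ultimately show thesis by (intro that[of s])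
qed

lemma W_star_inv_dense:
  assumes W: "W_star_algebra TYPE('b::cstar_algebra)"
  shows "inv_dense ({}::'b set)"
  unfolding inv_dense_def
proof (intro ballI impI allI)
  fix x :: 'b and e :: real
  assume x: "self_adjoint x" and e: "e > 0"
  obtain s where s: "self_adjoint s" "s * s = 1" "positive_el (x * s)"
    using W_star_symmetry[OF W x] by metis
  have "invertible_el (x * s + (e/2) *\<^sub>R 1 + 0)"
    using e by (intro invertible_positive_plus s) simp
  then obtain c where c: "(x * s + (e/2) *\<^sub>R 1) * c = 1" "c * (x * s + (e/2) *\<^sub>R 1) = 1"
    by (auto simp: invertible_el_def)
  \<comment> \<open>\<open>y\<close> is the symmetry \<open>s\<close> multiplied from the left by x
    s + e/2, which is invertible because \<open>x * s\<close> is positive.\<close>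
  define y where "y = x + (e/2) *\<^sub>R s"
  have y: "y = (x * s + (e/2) *\<^sub>R 1) * s" by (simp add: y_def distrib_right mult.assoc s(2))
  have "y * (s * c) = (x * s + (e/2) *\<^sub>R 1) * (s * s) * c" by (simp add: y mult.assoc)
  then have "y * (s * c) = 1" using c s(2) by simp
  moreover have "(s * c) * y = s * (c * (x * s + (e/2) *\<^sub>R 1)) * s" by (simp add: y mult.assoc)
  then have "(s * c) * y = 1" using c s(2) by simp
  ultimately have "invertible_el y" unfolding invertible_el_def by blast
  moreover have "self_adjoint y" unfolding y_def by (intro sa_intros x s)
  moreover have "norm (x - y) < e" using norm_symmetry[OF s(1,2)] e by (simp add: y_def)
  ultimately show "\<exists>y\<in>commutant {}. self_adjoint y \<and> invertible_el y \<and> norm (x - y) < e"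
    by (auto simp: commutant_def)
qed

section \<open>Maximal abelian subalgebras of von Neumann algebras\<close>

lemma star_subalgebra_commutant:
  assumes "\<And>x. x \<in> S \<Longrightarrow> cstar x \<in> S"
  shows "star_subalgebra (commutant S)"
  unfolding star_subalgebra_def
proof (intro conjI ballI allI)
  fix x assume x: "x \<in> commutant S"
  show "c *\<^sub>C x \<in> commutant S" for c
    using x by (simp add: commutant_def mult_scaleC_left mult_scaleC_right)
  show "cstar x \<in> commutant S"
  proof (rule commutantI)
    fix q assume "q \<in> S"
    then have "x * cstar q = cstar q * x" using x assms commutantD by blast
    from arg_cong[OF this, of cstar] show "cstar x * q = q * cstar x"
      by (simp add: cstar_mult cstar_cstar)
  qed
qed (auto intro: commutant_intros)

text \<open>The bicommutant of \<open>C \<union> {z}\<close> is an abelian star subalgebra.\<close>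
lemma masa_memI:
  assumes C: "masa C" and z: "self_adjoint z" "z \<in> commutant C"
  shows "z \<in> C"
proof -
  define S where "S = insert z C"
  have star: "cstar x \<in> S" if "x \<in> S" for x
    using that C z(1) by (auto simp: S_def masa_def star_subalgebra_def self_adjoint_def)
  have SS: "S \<subseteq> commutant S"
    using C z(2) by (auto simp: S_def commutant_def masa_def abelian_set_def)
  have sub: "S \<subseteq> commutant (commutant S)" by (auto simp: commutant_def)
  have "star_subalgebra (commutant S)" using star by (rule star_subalgebra_commutant)
  then have "star_subalgebra (commutant (commutant S))"
    by (intro star_subalgebra_commutant) (simp add: star_subalgebra_def)
  moreover have "abelian_set (commutant (commutant S))"
    unfolding abelian_set_def
  proof (intro ballI)
    fix x y assume xy: "x \<in> commutant (commutant S)" "y \<in> commutant (commutant S)"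
    have "y \<in> commutant S" using xy(2) SS by (auto simp: commutant_def)
    then show "x * y = y * x" by (rule commutantD[OF xy(1)])
  qed
  ultimately have "commutant (commutant S) = C"
    using C sub unfolding masa_def S_def by blast
  then show ?thesis using sub by (auto simp: S_def)
qed

lemma W_star_masas_spanned_by_projections:
  assumes W: "W_star_algebra TYPE('m::cstar_algebra)"
  shows "masas_spanned_by_projections TYPE('m)"
  unfolding masas_spanned_by_projections_def
proof (intro allI impI subsetI)
  fix C :: "'m set" and x0 assume C: "masa C" and x0: "x0 \<in> C"
  let ?P = "{p\<in>C. projection p}"
  have sub: "star_subalgebra C" and ab: "\<And>x y. x \<in> C \<Longrightarrow> y \<in> C \<Longrightarrow> x * y = y * x"
    using C by (auto simp: masa_def abelian_set_def)
  have "1 \<in> C" by (rule masa_memI[OF C]) (auto simp: commutant_1)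
  then have one: "1 \<in> cspan ?P" by (intro cspan_base) (simp add: projection_def)
  have CR: "r *\<^sub>R x \<in> C" if "x \<in> C" for r x using sub that by (simp add: star_subalgebra_def scaleR_scaleC)
  have Cdiff: "x - y \<in> C" if "x \<in> C" "y \<in> C" for x y
  proof -
    have "x + (- 1) *\<^sub>R y \<in> C" using sub that(1) CR[OF that(2)] unfolding star_subalgebra_def by blast
    then show ?thesis by simp
  qed
  have halve: "\<exists>s\<in>cspan ?P. self_adjoint s \<and> s \<in> C \<and> norm (x - (K/2) *\<^sub>R s) \<le> K / 2"
    if x: "x \<in> C" "self_adjoint x" "norm x \<le> K" for x K
  proof -
    obtain s where s: "self_adjoint s" "s * s = 1" "positive_el (x * s)" "\<And>z. z * x = x * z \<Longrightarrow> z * s = s * z"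
      using W_star_symmetry[OF W x(2)] by metis
    have K: "K \<ge> 0" using x(3) norm_ge_zero order_trans by blast
    \<comment> \<open>\<open>s\<close> commutes with everything that commutes with \<open>x\<close>,
      in particular with all of the abelian \<open>C\<close>.\<close>
    have sC: "s \<in> C"
      by (rule masa_memI[OF C s(1)], rule commutantI) (metis s(4) ab x(1))
    define g where "g = (1/2) *\<^sub>R (1 - s)"
    have "projection g" using s(1,2)
      by (simp add: g_def projection_def self_adjoint_def cstar_diff algebra_simps)
        (simp flip: scaleR_add_left)
    moreover have "g \<in> C" unfolding g_def by (intro CR Cdiff \<open>1 \<in> C\<close> sC)
    ultimately have "g \<in> cspan ?P" by (intro cspan_base) simp
    then have "1 - (2::complex) *\<^sub>C g \<in> cspan ?P" by (intro cspan_diff one cspan_scaleC)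
    moreover have "1 - (2::complex) *\<^sub>C g = s" using scaleR_scaleC[of 2 g] by (simp add: g_def)
    ultimately have sP: "s \<in> cspan ?P" by simp
    have ns: "norm s = 1" using norm_symmetry[OF s(1,2)] .
    \<comment> \<open>From 0 \<le> x s \<le> K, the element \<open>x * s\<close> lies within K/2 of
      the scalar K/2; multiplying by the symmetry \<open>s\<close> carries this over to
      \<open>x\<close>.\<close>
    have "norm ((K/2) *\<^sub>R 1 - x * s) \<le> K / 2"
    proof (rule norm_le_iff_positive)
      have sa: "self_adjoint (x * s)" using s(3) by (rule positive_el_sa)
      then show "self_adjoint ((K/2) *\<^sub>R 1 - x * s)" by (intro sa_intros)
      show "positive_el ((K/2) *\<^sub>R 1 - ((K/2) *\<^sub>R 1 - x * s))" using s(3) by simp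
      have "norm (x * s) \<le> K" using norm_mult_ineq[of x s] ns x(3) by simp
      from positive_bound(1)[OF sa this]
      show "positive_el ((K/2) *\<^sub>R 1 + ((K/2) *\<^sub>R 1 - x * s))"
        by (simp add: add_diff_eq flip: scaleR_add_left)
    qed (use K in simp)
    moreover have "x - (K/2) *\<^sub>R s = - (((K/2) *\<^sub>R 1 - x * s) * s)"
      using s(2) by (simp add: left_diff_distrib mult.assoc)
    then have "norm (x - (K/2) *\<^sub>R s) \<le> norm ((K/2) *\<^sub>R 1 - x * s) * norm s"
      by (simp add: norm_mult_ineq)
    ultimately have "norm (x - (K/2) *\<^sub>R s) \<le> K / 2" using ns by simp
    then show ?thesis using sP s(1) sC by blast
  qed
  have sa: "x \<in> closure (cspan ?P)" if x: "x \<in> C" "self_adjoint x" for x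
  proof -
    \<comment> \<open>Each application of \<open>halve\<close> to the remainder \<open>x - z\<close>
      halves the bound on its norm.\<close>
    have approx: "\<exists>z\<in>cspan ?P. z \<in> C \<and> self_adjoint z \<and> norm (x - z) \<le> norm x / 2 ^ n" for n
    proof (induction n)
      case 0
      have "0 \<in> C" using sub by (simp add: star_subalgebra_def)
      then show ?case by (intro bexI[of _ 0] cspan_0) auto
    next
      case (Suc n)
      then obtain z where z: "z \<in> cspan ?P" "z \<in> C" "self_adjoint z" "norm (x - z) \<le> norm x / 2 ^ n" by blast
      define K where "K = norm x / 2 ^ n"
      obtain s where s: "s \<in> cspan ?P" "self_adjoint s" "s \<in> C" "norm (x - z - (K/2) *\<^sub>R s) \<le> K / 2"
        using halve[OF Cdiff[OF x(1) z(2)] sa_diff[OF x(2) z(3)] z(4)] unfolding K_def by blast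
      have "z + (K/2) *\<^sub>R s \<in> cspan ?P" unfolding scaleR_scaleC by (intro cspan_add z cspan_scaleC s)
      moreover have "z + (K/2) *\<^sub>R s \<in> C" using sub z(2) CR[OF s(3)] by (simp add: star_subalgebra_def)
      moreover have "self_adjoint (z + (K/2) *\<^sub>R s)" by (intro sa_intros z s)
      moreover have "norm (x - (z + (K/2) *\<^sub>R s)) \<le> norm x / 2 ^ Suc n"
        using s(4) by (simp add: K_def diff_diff_eq)
      ultimately show ?case by blast
    qed
    show ?thesis
      unfolding closure_approachable
    proof (intro allI impI)
      fix e :: real assume e: "e > 0"
      have "(\<lambda>n. norm x / 2 ^ n) \<longlonglongrightarrow> 0" by (rule LIMSEQ_divide_realpow_zero) simp
      then obtain n where "norm x / 2 ^ n < e"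
        using order_tendstoD(2)[OF _ e] eventually_happens'[OF sequentially_bot] by blast
      moreover obtain z where "z \<in> cspan ?P" "norm (x - z) \<le> norm x / 2 ^ n" using approx by blast
      ultimately show "\<exists>z\<in>cspan ?P. dist z x < e"
        by (metis dist_commute dist_norm le_less_trans)
    qed
  qed
  have star: "star_subalgebra (closure (cspan ?P))"
    using C by (intro star_subalgebra_closure star_subalgebra_cspan_projections) (auto simp: masa_def)
  have C0: "cstar x0 \<in> C" "x0 + cstar x0 \<in> C" using sub x0 by (auto simp: star_subalgebra_def)
  have "re_part x0 \<in> C" unfolding re_part_def by (intro CR C0)
  moreover have "im_part x0 \<in> C"
  proof -
    have "\<i> *\<^sub>C (cstar x0 - x0) \<in> C" using sub Cdiff[OF C0(1) x0] by (simp add: star_subalgebra_def)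
    then show ?thesis unfolding im_part_def by (rule CR)
  qed
  ultimately have "re_part x0 + \<i> *\<^sub>C im_part x0 \<in> closure (cspan ?P)"
    using sa[OF _ sa_re_part] sa[OF _ sa_im_part] star unfolding star_subalgebra_def by blast
  then show "x0 \<in> closure (cspan ?P)" by (simp add: re_im_part)
qed

theorem theorem5p1:
  assumes "separable_alg TYPE('a::cstar_algebra)"
    and "commutative_alg TYPE('a)"
  shows "RR0_AW_projective TYPE('a) TYPE('b::cstar_algebra) TYPE('m::cstar_algebra)
       \<and> W_W_projective TYPE('a) TYPE('b) TYPE('m)"
  unfolding RR0_AW_projective_def W_W_projective_def
  using separable_commutative_lift[OF assms] real_rank_zero_inv_dense[where 'a = 'b]
    AW_star_masas_spanned_by_projections[where 'm = 'm] W_star_inv_dense[where 'b = 'b]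
    W_star_masas_spanned_by_projections[where 'm = 'm]
  by blast

end
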